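(* Fix integers $p\ge1$ and $k\ge1$. For each $n$ let $\mathbf{y}\in\mathbb{R}^n$ be a response vector and $\mathbf{X}\in\mathbb{R}^{n\times p}$ a covariate matrix (both depending on $n$), and suppose that for some positive definite matrix $\mathbf{Q}$, $$\lim_{n\to\infty}\frac1n\begin{bmatrix}\mathbf{y}^{\mathsf T}\mathbf{y}&\mathbf{y}^{\mathsf T}\mathbf{X}\\ \mathbf{X}^{\mathsf T}\mathbf{y}&\mathbf{X}^{\mathsf T}\mathbf{X}\end{bmatrix}=\mathbf{Q}=\begin{bmatrix}\mathbf{Q}_{yy}&\mathbf{Q}_{yx}\\ \mathbf{Q}_{xy}&\mathbf{Q}_{xx}\end{bmatrix}.$$ For each $n$ let $\mathbf{S}$ be a $k\times n$ Hadamard sketch (for every $n$) or a $k\times n$ Clarkson--Woodruff sketch (for every $n$), and put $\mathbf{y}_s=\mathbf{S}\mathbf{y}$, $\mathbf{X}_s=\mathbf{S}\mathbf{X}$. Then, as $n\to\infty$, in distribution, $$\frac1n\begin{pmatrix}\mathbf{y}_s^{\mathsf T}\mathbf{y}_s&\mathbf{y}_s^{\mathsf T}\mathbf{X}_s\\ \mathbf{X}_s^{\mathsf T}\mathbf{y}_s&\mathbf{X}_s^{\mathsf T}\mathbf{X}_s\end{pmatrix}\longrightarrow W_{p+1}\left\{k,\frac1k\begin{bmatrix}\mathbf{Q}_{yy}&\mathbf{Q}_{yx}\\ \mathbf{Q}_{xy}&\mathbf{Q}_{xx}\end{bmatrix}\right\}.$$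
   Context: $W_d\{k,\boldsymbol{\Sigma}\}$ is the Wishart distribution, the law of $\sum_{i=1}^k\mathbf{g}_i\mathbf{g}_i^{\mathsf T}$ with $\mathbf{g}_i$ i.i.d. $N(\mathbf{0}_d,\boldsymbol{\Sigma})$. Clarkson--Woodruff sketch: the columns of $\mathbf{S}$ are independent; column $j$ has a single nonzero entry, equal to $\pm1$ with probability $1/2$ each, in a row chosen uniformly from $\{1,\dots,k\}$ independently of the sign. Hadamard sketch: $\mathbf{S}=k^{-1/2}\boldsymbol{\Phi}\mathbf{H}\mathbf{D}$, where $\mathbf{D}$ is diagonal with i.i.d. uniform $\pm1$ entries, $\mathbf{H}$ is the $n\times n$ Hadamard matrix (entries $\pm1$, $\mathbf{H}\mathbf{H}^{\mathsf T}=n\mathbf{I}$), and $\boldsymbol{\Phi}$ is $k\times n$, independent of $\mathbf{D}$, selecting $k$ rows uniformly at random with replacement; $n$ is taken to be a power of 2, or the data are padded with zero rows up to the next power of 2.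
   Formalization: Added: either rows accumulate as n grows, or max_i (y_i^2+|x_i|^2)/n tends to 0. Without this the claim fails: p=k=1, y=sqrt(n)e_1, X=sqrt(n)e_2 gives Gram limit I, but y_s^T y_s/n is always 1, not chi-squared. *)

theory Defs
  imports "HOL-Probability.Probability"
begin

section \<open>Convergence in distribution, Gaussian and Wishart laws\<close>

text \<open>The library's \<open>weak_conv_m\<close> is for measures on the real line only.\<close>

definition converges_in_law :: "(nat \<Rightarrow> 'a::topological_space measure) \<Rightarrow> 'a measure \<Rightarrow> bool" where
  "converges_in_law \<mu> \<nu> \<longleftrightarrow>
     (\<forall>f :: 'a \<Rightarrow> real. continuous_on UNIV f \<longrightarrow> bounded (range f) \<longrightarrow>
        (\<lambda>n. \<integral>x. f x \<partial>\<mu> n) \<longlonglongrightarrow> (\<integral>x. f x \<partial>\<nu>))"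

definition positive_definite :: "real ^ 'd ^ 'd \<Rightarrow> bool" where
  "positive_definite A \<longleftrightarrow> transpose A = A \<and> (\<forall>v. v \<noteq> 0 \<longrightarrow> 0 < v \<bullet> (A *v v))"

text \<open>The law $N(0,\Sigma)$, given by its density; meaningful for positive definite
  \<open>\<Sigma>\<close>, the only case needed.\<close>

definition mv_normal :: "real ^ 'd ^ 'd \<Rightarrow> (real ^ 'd) measure" where
  "mv_normal \<Sigma> = density lborel (\<lambda>x.
     ennreal (exp (- (x \<bullet> (matrix_inv \<Sigma> *v x)) / 2) / sqrt ((2 * pi) ^ CARD('d) * det \<Sigma>)))"

definition outer :: "real ^ 'd \<Rightarrow> real ^ 'd ^ 'd" where
  "outer g = (\<chi> a b. g $ a * g $ b)"

definition wishart :: "nat \<Rightarrow> real ^ 'd ^ 'd \<Rightarrow> (real ^ 'd ^ 'd) measure" where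
  "wishart k \<Sigma> = distr (PiM {..<k} (\<lambda>_. mv_normal \<Sigma>)) borel (\<lambda>g. \<Sum>i<k. outer (g i))"

section \<open>Data and block Gram matrices\<close>

text \<open>A data set with \<open>m\<close> rows is a response \<open>y\<close> and a covariate matrix \<open>X\<close> whose
  row \<open>i\<close> is \<open>X i\<close>; only the entries with \<open>i < m\<close> are used. The \<open>p + 1\<close> coordinates
  of the block matrices are indexed by \<open>'p option\<close>: \<open>None\<close> is the response and \<open>Some j\<close>
  is covariate \<open>j\<close>.\<close>

definition block_gram :: "nat \<Rightarrow> (nat \<Rightarrow> real) \<Rightarrow> (nat \<Rightarrow> real ^ 'p) \<Rightarrow> real ^ 'p option ^ 'p option" where
  "block_gram m y X = (\<chi> a b.
     case a of
       None \<Rightarrow> (case b of None \<Rightarrow> \<Sum>i<m. y i * y i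
                        | Some j \<Rightarrow> \<Sum>i<m. y i * X i $ j)
     | Some l \<Rightarrow> (case b of None \<Rightarrow> \<Sum>i<m. X i $ l * y i
                          | Some j \<Rightarrow> \<Sum>i<m. X i $ l * X i $ j))"

definition zero_pad :: "nat \<Rightarrow> (nat \<Rightarrow> 'a::zero) \<Rightarrow> nat \<Rightarrow> 'a" where
  "zero_pad n v i = (if i < n then v i else 0)"

text \<open>The rows accumulate: passing from sample size \<open>n\<close> to \<open>Suc n\<close> appends one
  observation.\<close>

definition accumulating :: "(nat \<Rightarrow> nat \<Rightarrow> real) \<Rightarrow> (nat \<Rightarrow> nat \<Rightarrow> real ^ 'p) \<Rightarrow> bool" where
  "accumulating y X \<longleftrightarrow> (\<forall>n. \<forall>i<n. y (Suc n) i = y n i \<and> X (Suc n) i = X n i)"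

text \<open>For unrelated data sets at different \<open>n\<close>: no single row carries a non-vanishing
  share of the Gram matrix. When the normalised Gram matrices converge to a positive definite
  matrix this says that the maximal leverage tends to zero, and it then holds for all
  accumulating data. Without it the limit law need not be Wishart: take $n \ge 2$, $p = k = 1$,
  $y = \sqrt n\, e_1$ and $X = \sqrt n\, e_2$; then the normalised Gram matrix is the identity,
  but \<open>S y / sqrt n\<close> is always 1 or -1.\<close>

definition negligible_rows :: "(nat \<Rightarrow> nat \<Rightarrow> real) \<Rightarrow> (nat \<Rightarrow> nat \<Rightarrow> real ^ 'p) \<Rightarrow> bool" where
  "negligible_rows y X \<longleftrightarrow>
     (\<forall>\<epsilon>>0. \<forall>\<^sub>F n in sequentially. \<forall>i<n. ((y n i)\<^sup>2 + (norm (X n i))\<^sup>2) / real n < \<epsilon>)"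

section \<open>Sketches\<close>

text \<open>A random \<open>k \<times> m\<close> sketching matrix is given by its law, a finitely supported
  distribution on functions \<open>nat \<Rightarrow> nat \<Rightarrow> real\<close> (row index first).\<close>

definition rademacher :: "real pmf" where
  "rademacher = pmf_of_set {-1, 1}"

definition cw_sketch :: "nat \<Rightarrow> nat \<Rightarrow> (nat \<Rightarrow> nat \<Rightarrow> real) pmf" where
  "cw_sketch k m =
     map_pmf (\<lambda>c i j. if j < m \<and> i = fst (c j) then snd (c j) else 0)
       (Pi_pmf {..<m} (0, 0) (\<lambda>_. pair_pmf (pmf_of_set {..<k}) rademacher))"

definition hadamard_matrix :: "nat \<Rightarrow> (nat \<Rightarrow> nat \<Rightarrow> real) \<Rightarrow> bool" where
  "hadamard_matrix m H \<longleftrightarrow>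
     (\<forall>i<m. \<forall>j<m. H i j \<in> {-1, 1}) \<and>
     (\<forall>i<m. \<forall>j<m. (\<Sum>l<m. H i l * H j l) = (if i = j then real m else 0))"

text \<open>The product $k^{-1/2}\Phi H D$: \<open>r i\<close> is the row selected by row \<open>i\<close> of $\Phi$,
  and \<open>d\<close> is the diagonal of $D$.\<close>

definition hadamard_sketch :: "nat \<Rightarrow> nat \<Rightarrow> (nat \<Rightarrow> nat \<Rightarrow> real) \<Rightarrow> (nat \<Rightarrow> nat \<Rightarrow> real) pmf" where
  "hadamard_sketch k m H =
     map_pmf (\<lambda>(r, d) i j.
         (\<Sum>a<m. \<Sum>b<m. (if a = r i then 1 else 0) * H a b * (if b = j then d b else 0)) / sqrt (real k))
       (pair_pmf (Pi_pmf {..<k} 0 (\<lambda>_. pmf_of_set {..<m})) (Pi_pmf {..<m} 0 (\<lambda>_. rademacher)))"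

definition next_pow2 :: "nat \<Rightarrow> nat" where
  "next_pow2 n = 2 ^ (LEAST e. n \<le> 2 ^ e)"

definition sketched_response :: "nat \<Rightarrow> (nat \<Rightarrow> nat \<Rightarrow> real) \<Rightarrow> (nat \<Rightarrow> real) \<Rightarrow> nat \<Rightarrow> real" where
  "sketched_response m S y i = (\<Sum>j<m. S i j * y j)"

definition sketched_covariates ::
    "nat \<Rightarrow> (nat \<Rightarrow> nat \<Rightarrow> real) \<Rightarrow> (nat \<Rightarrow> real ^ 'p) \<Rightarrow> nat \<Rightarrow> real ^ 'p" where
  "sketched_covariates m S X i = (\<Sum>j<m. S i j *\<^sub>R X j)"

text \<open>The law of the normalised Gram matrix of the sketched data, for sample size \<open>n\<close> and a
  sketching matrix with \<open>m \<ge> n\<close> columns that acts on the data padded with zero rows.\<close>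

definition sketched_gram_law ::
    "nat \<Rightarrow> nat \<Rightarrow> nat \<Rightarrow> (nat \<Rightarrow> nat \<Rightarrow> real) pmf \<Rightarrow> (nat \<Rightarrow> real) \<Rightarrow> (nat \<Rightarrow> real ^ 'p) \<Rightarrow>
      (real ^ 'p option ^ 'p option) measure" where
  "sketched_gram_law k n m \<S> y X =
     distr (measure_pmf \<S>) borel (\<lambda>S. (1 / real n) *\<^sub>R
       block_gram k (sketched_response m S (zero_pad n y)) (sketched_covariates m S (zero_pad n X)))"

end

(* Stack the rows of the sketched data, divided by sqrt n, into a random family of k vectors Z_i. The
normalised Gram matrix is the continuous image of Z under the sum of the outer products Z_i Z_i^T, so
it is enough that Z converges in law to k independent N(0, Q/k) vectors.

By a multivariate Levy continuity theorem this may be tested on characteristic functions: the real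
functions g for which multiplication by g preserves "E h(Z) exp(i l(Z)) converges for every linear l"
form an algebra that contains sin l and cos l, and Stone-Weierstrass applies to it on compact sets.

Write w_j for the normalised rows of the data and t_i for the test vectors. The columns of a
Clarkson-Woodruff sketch are independent, and the characteristic function is the product over j of
the mean over i of cos(t_i . w_j). For a Hadamard sketch, given the selected rows r_i of H, it is the
product over j of cos(u_j) with u_j = k^(-1/2) sum_i H(r_i, j) (t_i . w_j). Since max_j |w_j| tends to
0, both products are close to Gaussians in the sums of squares; for the Hadamard sketch the cross
terms (i, l), i different from l, of sum_j u_j^2 are small in mean, by Bessel's inequality for the
rows of H. *)

theory Submission
  imports Defs
begin

section \<open>Convergence in law from characteristic functions\<close>

text \<open>Restriction to compact sets presupposes tightness, and this comes from the real line:
  every scalar coordinate of \<open>Z\<close> obeys the one-dimensional continuity theorem, which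
  bounds its tails, and a union bound over the finitely many coordinates yields a box that carries
  almost all mass. The limit law is defined by a density. Its characteristic function is reached by
  writing the covariance as A A^T and substituting x = A u, whence the linear change of variables.
  The factor 1/k in the covariance has two origins: a Clarkson-Woodruff column lands in a given row
  with probability 1/k, while the Hadamard sketch carries the factor k^(-1/2), which gets squared.
  Independence of the limiting rows also arises differently: a Clarkson-Woodruff column has a single
  nonzero entry, so different \<open>t i\<close> never meet inside one cosine, whereas Hadamard rows
  do mix and decouple only on average over the selected rows. In both cases the random signs turn
  exponentials into cosines, and the error is controlled by a bound on single rows that tends to 0
  and a total sum of squares that converges.\<close>

lemma tail_le_of_char_convergence:
  fixes M :: "nat \<Rightarrow> 'a measure" and N :: "'a measure" and l :: "'a \<Rightarrow> real"
  assumes M: "\<And>n. prob_space (M n)" and N: "prob_space N"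
    and lM [measurable]: "\<And>n. l \<in> borel_measurable (M n)"
    and lN [measurable]: "l \<in> borel_measurable N"
    and char: "\<And>s. (\<lambda>n. \<integral>x. iexp (s * l x) \<partial>M n) \<longlonglongrightarrow> (\<integral>x. iexp (s * l x) \<partial>N)"
    and e: "e > 0"
  shows "\<exists>R\<ge>0. (\<forall>\<^sub>F n in sequentially. measure (M n) {x \<in> space (M n). \<bar>l x\<bar> > R} \<le> e)
    \<and> measure N {x \<in> space N. \<bar>l x\<bar> > R} \<le> e"
proof -
  interpret N: prob_space N by fact
  interpret M: prob_space "M n" for n by fact
  have w: "weak_conv_m (\<lambda>n. distr (M n) borel l) (distr N borel l)"
  proof (rule levy_continuity)
    show "real_distribution (distr (M n) borel l)" for n
      by (simp add: M.real_distribution_distr)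
    show "real_distribution (distr N borel l)"
      by (simp add: N.real_distribution_distr)
    show "(\<lambda>n. char (distr (M n) borel l) t) \<longlonglongrightarrow> char (distr N borel l) t" for t
      using char[of t] by (simp add: char_def integral_distr)
  qed
  define T where "T n = {x \<in> space N. \<bar>l x\<bar> > real n}" for n :: nat
  have "(\<lambda>n. measure N (T n)) \<longlonglongrightarrow> measure N (\<Inter>n. T n)"
    by (rule N.finite_Lim_measure_decseq) (auto simp: T_def decseq_def)
  moreover have "(\<Inter>n. T n) = {}"
  proof -
    have "\<exists>n. \<not> \<bar>l x\<bar> > real n" for x
      using reals_Archimedean2[of "\<bar>l x\<bar>"] by (auto simp: not_less intro: less_imp_le)
    then show ?thesis by (auto simp: T_def)
  qed
  ultimately have "(\<lambda>n. measure N (T n)) \<longlonglongrightarrow> 0" by simp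
  then have "\<forall>\<^sub>F n in sequentially. measure N (T n) < e"
    using e by (rule order_tendstoD)
  then obtain m where m: "measure N (T m) < e"
    by (auto simp: eventually_sequentially)
  \<comment> \<open>A continuous cutoff that is 0 for |x| at most m and 1 for |x| at least m + 1.
    Its integral therefore dominates the tail beyond m + 1 under \<open>M n\<close> and is dominated
    by the tail beyond m under \<open>N\<close>, where the bound by \<open>e\<close> is strict and
    so survives the passage to the limit.\<close>
  define g where "g x = min 1 (max 0 (\<bar>x\<bar> - real m))" for x :: real
  have g_cont: "continuous_on UNIV g" unfolding g_def by (intro continuous_intros)
  have [measurable]: "g \<in> borel_measurable borel"
    using g_cont by (rule borel_measurable_continuous_onI)
  have g01: "0 \<le> g x" "g x \<le> 1" for x by (auto simp: g_def)
  have "(\<lambda>n. integral\<^sup>L (distr (M n) borel l) g) \<longlonglongrightarrow> integral\<^sup>L (distr N borel l) g"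
  proof (rule weak_conv_imp_integral_bdd_continuous_conv[OF _ _ w])
    show "real_distribution (distr (M n) borel l)" for n
      by (simp add: M.real_distribution_distr)
    show "real_distribution (distr N borel l)"
      by (simp add: N.real_distribution_distr)
    show "isCont g x" for x using g_cont by (simp add: continuous_on_eq_continuous_at)
    show "norm (g x) \<le> 1" for x using g01[of x] by auto
  qed
  then have lim: "(\<lambda>n. \<integral>x. g (l x) \<partial>M n) \<longlonglongrightarrow> (\<integral>x. g (l x) \<partial>N)"
    by (simp add: integral_distr)
  have intM: "integrable (M n) (\<lambda>x. g (l x))" for n
    by (rule M.integrable_const_bound[where B=1]) (use g01 in auto)
  have intN: "integrable N (\<lambda>x. g (l x))"
    by (rule N.integrable_const_bound[where B=1]) (use g01 in auto)
  have "(\<integral>x. g (l x) \<partial>N) \<le> (\<integral>x. indicator (T m) x \<partial>N)"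
    by (rule integral_mono) (use intN in \<open>auto simp: T_def g_def indicator_def intro!: N.integrable_const_bound[where B=1]\<close>)
  also have "\<dots> = measure N (T m)" by (simp add: T_def)
  finally have "(\<integral>x. g (l x) \<partial>N) < e" using m by simp
  with lim have ev: "\<forall>\<^sub>F n in sequentially. (\<integral>x. g (l x) \<partial>M n) < e"
    by (rule order_tendstoD)
  have le: "measure (M n) {x \<in> space (M n). \<bar>l x\<bar> > real m + 1} \<le> (\<integral>x. g (l x) \<partial>M n)" for n
  proof -
    have "measure (M n) {x \<in> space (M n). \<bar>l x\<bar> > real m + 1}
      = (\<integral>x. indicator {x \<in> space (M n). \<bar>l x\<bar> > real m + 1} x \<partial>M n)" by simp
    also have "\<dots> \<le> (\<integral>x. g (l x) \<partial>M n)"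
      by (rule integral_mono) (use intM in \<open>auto simp: g_def indicator_def intro!: M.integrable_const_bound[where B=1]\<close>)
    finally show ?thesis .
  qed
  have "measure N {x \<in> space N. \<bar>l x\<bar> > real m + 1} \<le> measure N (T m)"
    by (rule N.finite_measure_mono) (auto simp: T_def)
  with m have "measure N {x \<in> space N. \<bar>l x\<bar> > real m + 1} \<le> e" by simp
  moreover from ev have "\<forall>\<^sub>F n in sequentially. measure (M n) {x \<in> space (M n). \<bar>l x\<bar> > real m + 1} \<le> e"
    by eventually_elim (use le in \<open>meson le_less_trans less_imp_le\<close>)
  ultimately show ?thesis by (intro exI[of _ "real m + 1"]) auto
qed

text \<open>The functionals in \<open>L\<close> need not separate all points of the type: a product measure is
  carried by extensional functions, and only those are told apart by finitely many coordinates.\<close>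

locale functional_char_convergence =
  fixes M :: "nat \<Rightarrow> 'a::t2_space measure" and N :: "'a measure" and L :: "('a \<Rightarrow> real) set"
  assumes prob_M: "\<And>n. prob_space (M n)" and prob_N: "prob_space N"
    and L_cont: "\<And>l. l \<in> L \<Longrightarrow> continuous_on UNIV l"
    and L_meas_M: "\<And>l n. l \<in> L \<Longrightarrow> l \<in> borel_measurable (M n)"
    and L_meas_N: "\<And>l. l \<in> L \<Longrightarrow> l \<in> borel_measurable N"
    and L_zero: "(\<lambda>_. 0) \<in> L"
    and L_add: "\<And>l m. l \<in> L \<Longrightarrow> m \<in> L \<Longrightarrow> (\<lambda>x. l x + m x) \<in> L"
    and L_scale: "\<And>c l. l \<in> L \<Longrightarrow> (\<lambda>x. c * l x) \<in> L"
    and char: "\<And>l. l \<in> L \<Longrightarrow> (\<lambda>n. \<integral>x. iexp (l x) \<partial>M n) \<longlonglongrightarrow> (\<integral>x. iexp (l x) \<partial>N)"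
begin

sublocale M: prob_space "M n" for n by (rule prob_M)
sublocale N: prob_space N by (rule prob_N)

definition bounded_measurable :: "('a \<Rightarrow> 'b::{real_normed_vector}) \<Rightarrow> bool" where
  "bounded_measurable h \<longleftrightarrow>
     (\<exists>B. \<forall>x. norm (h x) \<le> B) \<and> (\<forall>n. h \<in> borel_measurable (M n)) \<and> h \<in> borel_measurable N"

lemma bounded_measurable_integrable:
  fixes h :: "'a \<Rightarrow> 'b::{banach, second_countable_topology}"
  assumes "bounded_measurable h"
  shows "integrable (M n) h" "integrable N h"
proof -
  obtain B where "\<forall>x. norm (h x) \<le> B" using assms by (auto simp: bounded_measurable_def)
  with assms show "integrable (M n) h" "integrable N h"
    by (auto simp: bounded_measurable_def intro!: M.integrable_const_bound[where B=B]
        N.integrable_const_bound[where B=B])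
qed

lemma bounded_measurable_const: "bounded_measurable (\<lambda>_. c)"
  by (auto simp: bounded_measurable_def)

lemma bounded_measurable_mult:
  fixes f g :: "'a \<Rightarrow> 'b::{real_normed_algebra, second_countable_topology}"
  assumes "bounded_measurable f" "bounded_measurable g"
  shows "bounded_measurable (\<lambda>x. f x * g x)"
proof -
  obtain B C where B: "\<And>x. norm (f x) \<le> B" and C: "\<And>x. norm (g x) \<le> C"
    using assms by (auto simp: bounded_measurable_def)
  have "norm (f x * g x) \<le> B * C" for x
    using norm_mult_ineq[of "f x" "g x"] mult_mono[OF B C, of x x] norm_ge_zero order_trans
    by (metis B)
  then show ?thesis using assms
    by (auto simp: bounded_measurable_def intro!: borel_measurable_times)
qed

lemma bounded_measurable_add:
  fixes f g :: "'a \<Rightarrow> 'b::{real_normed_vector, second_countable_topology}"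
  assumes "bounded_measurable f" "bounded_measurable g"
  shows "bounded_measurable (\<lambda>x. f x + g x)"
proof -
  obtain B C where B: "\<And>x. norm (f x) \<le> B" and C: "\<And>x. norm (g x) \<le> C"
    using assms by (auto simp: bounded_measurable_def)
  have "norm (f x + g x) \<le> B + C" for x
    using norm_triangle_le add_mono[OF B C] by blast
  then show ?thesis using assms
    by (auto simp: bounded_measurable_def intro!: borel_measurable_add)
qed

lemma bounded_measurable_iexp: "l \<in> L \<Longrightarrow> bounded_measurable (\<lambda>x. iexp (l x))"
  using L_meas_M L_meas_N by (auto simp: bounded_measurable_def intro!: exI[of _ 1])

section \<open>The algebra of multipliers\<close>

definition converging :: "('a \<Rightarrow> complex) \<Rightarrow> bool" where
  "converging h \<longleftrightarrow> (\<lambda>n. integral\<^sup>L (M n) h) \<longlonglongrightarrow> integral\<^sup>L N h"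

text \<open>Convergence is demanded after every twist by a character so that the property is stable
  under multiplication by another one: \<open>iexp (l x) * iexp (m x)\<close> is the character of
  \<open>l + m\<close>, which lies in \<open>L\<close> again.\<close>

definition twist_converging :: "('a \<Rightarrow> complex) \<Rightarrow> bool" where
  "twist_converging h \<longleftrightarrow> bounded_measurable h \<and> (\<forall>l\<in>L. converging (\<lambda>x. h x * iexp (l x)))"

text \<open>Defining the class by what multiplication preserves makes closure under products a mere
  composition of two such maps, with no expansion into trigonometric sums. The values are real
  because the approximation theorem applied later is about real functions.\<close>

definition multiplier :: "('a \<Rightarrow> real) \<Rightarrow> bool" where
  "multiplier g \<longleftrightarrow> continuous_on UNIV g \<and> bounded_measurable g \<and>
     (\<forall>h. twist_converging h \<longrightarrow> twist_converging (\<lambda>x. h x * complex_of_real (g x)))"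

lemma converging_add:
  assumes "bounded_measurable f" "bounded_measurable g" "converging f" "converging g"
  shows "converging (\<lambda>x. f x + g x)"
  using assms by (simp add: converging_def bounded_measurable_integrable tendsto_add)

lemma converging_scale: "converging f \<Longrightarrow> converging (\<lambda>x. c * f x)"
  by (simp add: converging_def tendsto_mult_left)

lemma twist_converging_add:
  assumes "twist_converging f" "twist_converging g"
  shows "twist_converging (\<lambda>x. f x + g x)"
  using assms
  by (auto simp: twist_converging_def bounded_measurable_add ring_distribs
      intro!: converging_add bounded_measurable_mult bounded_measurable_iexp)

lemma twist_converging_scale:
  assumes "twist_converging f"
  shows "twist_converging (\<lambda>x. c * f x)"
  using assms
  by (auto simp: twist_converging_def mult.assoc
      intro!: converging_scale bounded_measurable_mult bounded_measurable_const)

lemma twist_converging_iexp: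
  assumes h: "twist_converging h" and l: "l \<in> L"
  shows "twist_converging (\<lambda>x. h x * iexp (l x))"
  unfolding twist_converging_def
proof (intro conjI ballI)
  show "bounded_measurable (\<lambda>x. h x * iexp (l x))"
    using h l by (auto simp: twist_converging_def intro!: bounded_measurable_mult bounded_measurable_iexp)
  fix m assume "m \<in> L"
  then have "converging (\<lambda>x. h x * iexp (l x + m x))"
    using h L_add[OF l, of m] by (auto simp: twist_converging_def dest: bspec[of _ _ "\<lambda>x. l x + m x"])
  then show "converging (\<lambda>x. h x * iexp (l x) * iexp (m x))"
    by (simp add: exp_add ring_distribs mult.assoc)
qed

lemma multiplier_const: "multiplier (\<lambda>_. c)"
  using twist_converging_scale[where c="complex_of_real c"]
  by (simp add: multiplier_def bounded_measurable_const mult.commute)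

lemma multiplier_mult:
  assumes f: "multiplier f" and g: "multiplier g"
  shows "multiplier (\<lambda>x. f x * g x)"
proof -
  have "twist_converging (\<lambda>x. h x * complex_of_real (f x * g x))" if h: "twist_converging h" for h
  proof -
    have "twist_converging (\<lambda>x. h x * complex_of_real (f x))"
      using f h by (auto simp: multiplier_def)
    then have "twist_converging (\<lambda>x. h x * complex_of_real (f x) * complex_of_real (g x))"
      using g unfolding multiplier_def by blast
    then show ?thesis by (simp add: mult.assoc)
  qed
  with f g show ?thesis
    by (auto simp: multiplier_def intro!: continuous_intros bounded_measurable_mult)
qed

lemma multiplier_add:
  assumes f: "multiplier f" and g: "multiplier g"
  shows "multiplier (\<lambda>x. f x + g x)"
proof -
  have "twist_converging (\<lambda>x. h x * complex_of_real (f x + g x))" if h: "twist_converging h" for h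
  proof -
    have "twist_converging (\<lambda>x. h x * complex_of_real (f x) + h x * complex_of_real (g x))"
      using f g h by (auto simp: multiplier_def intro!: twist_converging_add)
    then show ?thesis by (simp add: ring_distribs)
  qed
  with f g show ?thesis
    by (auto simp: multiplier_def intro!: continuous_intros bounded_measurable_add)
qed

lemma multiplier_cos:
  assumes l: "l \<in> L"
  shows "multiplier (\<lambda>x. cos (l x))"
proof -
  have ml: "(\<lambda>x. - 1 * l x) \<in> L" by (rule L_scale[OF l])
  have eq: "complex_of_real (cos t) = 1/2 * (iexp t + iexp (- 1 * t))" for t
    by (simp add: cos_exp_eq[of "complex_of_real t", unfolded cos_of_real] mult.commute)
  have "twist_converging (\<lambda>x. h x * complex_of_real (cos (l x)))" if h: "twist_converging h" for h
  proof -
    have "twist_converging (\<lambda>x. 1/2 * (h x * iexp (l x) + h x * iexp (- 1 * l x)))"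
      by (intro twist_converging_scale twist_converging_add twist_converging_iexp h l ml)
    moreover have "(\<lambda>x. 1/2 * (h x * iexp (l x) + h x * iexp (- 1 * l x))) = (\<lambda>x. h x * complex_of_real (cos (l x)))"
      unfolding eq by (simp add: algebra_simps)
    ultimately show ?thesis by simp
  qed
  moreover have "bounded_measurable (\<lambda>x. cos (l x))"
    using L_meas_M[OF l] L_meas_N[OF l] by (auto simp: bounded_measurable_def intro!: exI[of _ 1])
  ultimately show ?thesis
    using L_cont[OF l] by (auto simp: multiplier_def intro!: continuous_intros)
qed

lemma multiplier_sin:
  assumes l: "l \<in> L"
  shows "multiplier (\<lambda>x. sin (l x))"
proof -
  have ml: "(\<lambda>x. - 1 * l x) \<in> L" by (rule L_scale[OF l])
  have eq: "complex_of_real (sin t) = - \<i>/2 * (iexp t + - 1 * iexp (- 1 * t))" for t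
    by (simp add: sin_exp_eq[of "complex_of_real t", unfolded sin_of_real] mult.commute field_simps)
  have "twist_converging (\<lambda>x. h x * complex_of_real (sin (l x)))" if h: "twist_converging h" for h
  proof -
    have "twist_converging (\<lambda>x. - \<i>/2 * (h x * iexp (l x) + - 1 * (h x * iexp (- 1 * l x))))"
      by (intro twist_converging_scale twist_converging_add twist_converging_iexp h l ml)
    moreover have "(\<lambda>x. - \<i>/2 * (h x * iexp (l x) + - 1 * (h x * iexp (- 1 * l x)))) = (\<lambda>x. h x * complex_of_real (sin (l x)))"
      unfolding eq by (simp add: algebra_simps)
    ultimately show ?thesis by simp
  qed
  moreover have "bounded_measurable (\<lambda>x. sin (l x))"
    using L_meas_M[OF l] L_meas_N[OF l] by (auto simp: bounded_measurable_def intro!: exI[of _ 1])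
  ultimately show ?thesis
    using L_cont[OF l] by (auto simp: multiplier_def intro!: continuous_intros)
qed

text \<open>Serves the truncation of an approximant: truncation itself is not known to preserve the
  class, but polynomials close to it do, since the class is an algebra.\<close>

lemma multiplier_polynomial:
  fixes q :: "real \<Rightarrow> real"
  assumes "real_polynomial_function q" "multiplier g"
  shows "multiplier (\<lambda>x. q (g x))"
  using assms
proof (induction q rule: real_polynomial_function.induct)
  case (linear f)
  then obtain c where "f = (\<lambda>x. x * c)" using real_bounded_linear by blast
  then show ?case using multiplier_mult[OF linear(2) multiplier_const] by simp
qed (auto intro: multiplier_const multiplier_add multiplier_mult)

text \<open>The constant 1 is twist converging; this is exactly the hypothesis on characteristic
  functions. Multiplying it by \<open>g\<close> and testing against the zero functional gives the
  claim.\<close>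

lemma multiplier_converges:
  assumes "multiplier g"
  shows "(\<lambda>n. \<integral>x. g x \<partial>M n) \<longlonglongrightarrow> (\<integral>x. g x \<partial>N)"
proof -
  have "twist_converging (\<lambda>_. 1)"
    using char by (auto simp: twist_converging_def converging_def bounded_measurable_const)
  then have "twist_converging (\<lambda>x. complex_of_real (g x))"
    using assms unfolding multiplier_def by force
  then have "converging (\<lambda>x. complex_of_real (g x))"
    using L_zero unfolding twist_converging_def by force
  then show ?thesis
    by (simp add: converging_def integral_complex_of_real tendsto_of_real_iff)
qed

lemma multiplier_separates:
  assumes "l \<in> L" "l x \<noteq> l y"
  shows "\<exists>g. multiplier g \<and> g x \<noteq> g y"
proof -
  \<comment> \<open>This scale makes the two phases differ by exactly pi. Sine and cosine then both
    change sign between the points, and they cannot both vanish.\<close>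
  define s where "s = pi / (l x - l y)"
  have sl: "(\<lambda>x. s * l x) \<in> L" by (rule L_scale[OF assms(1)])
  have "s * l x = s * l y + pi" using assms by (simp add: s_def field_simps)
  then have 1: "cos (s * l x) = - cos (s * l y)" "sin (s * l x) = - sin (s * l y)"
    by simp_all
  have "cos (s * l y) \<noteq> 0 \<or> sin (s * l y) \<noteq> 0"
    using sin_cos_squared_add[of "s * l y"] by force
  then show ?thesis
  proof
    assume "cos (s * l y) \<noteq> 0"
    with 1 show ?thesis by (intro exI[of _ "\<lambda>x. cos (s * l x)"] conjI multiplier_cos[OF sl]) simp
  next
    assume "sin (s * l y) \<noteq> 0"
    with 1 show ?thesis by (intro exI[of _ "\<lambda>x. sin (s * l x)"] conjI multiplier_sin[OF sl]) simp
  qed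
qed

text \<open>On a compact set a multiplier \<open>g\<close> approximates \<open>f\<close>; a polynomial that is uniformly close on the
  range of \<open>g\<close> to truncation at the bound of \<open>f\<close> keeps the approximant bounded off the compact set.\<close>

lemma bounded_multiplier_approximation:
  fixes f :: "'a \<Rightarrow> real"
  assumes f: "continuous_on UNIV f" and B: "\<And>x. \<bar>f x\<bar> \<le> B"
    and K: "compact K" and sep: "\<And>x y. x \<in> K \<Longrightarrow> y \<in> K \<Longrightarrow> x \<noteq> y \<Longrightarrow> \<exists>l\<in>L. l x \<noteq> l y"
    and e: "e > 0"
  shows "\<exists>g. multiplier g \<and> (\<forall>x\<in>K. \<bar>f x - g x\<bar> \<le> 2 * e) \<and> (\<forall>x. \<bar>f x - g x\<bar> \<le> 2 * B + e)"
proof -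
  interpret R: function_ring_on "Collect multiplier" K
  proof
    show "compact K" by fact
    show "\<exists>f\<in>Collect multiplier. f x \<noteq> f y" if "x \<in> K" "y \<in> K" "x \<noteq> y" for x y
      using sep[OF that] multiplier_separates by blast
    show "continuous_on K f" if "f \<in> Collect multiplier" for f
      using that by (auto simp: multiplier_def intro: continuous_on_subset)
  qed (auto intro: multiplier_const multiplier_add multiplier_mult)
  obtain g where g: "multiplier g" and gK: "\<And>x. x \<in> K \<Longrightarrow> \<bar>f x - g x\<bar> < e"
    using R.Stone_Weierstrass_basic[OF continuous_on_subset[OF f] e] by auto
  obtain C where C: "\<And>x. \<bar>g x\<bar> \<le> C"
    using g by (auto simp: multiplier_def bounded_measurable_def)
  \<comment> \<open>Truncation to the range allowed for \<open>f\<close> fixes the values of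
    \<open>f\<close> and does not increase distances, so on \<open>K\<close> the distance from
    \<open>f\<close> to \<open>clip (g x)\<close> is no larger than that to
    \<open>g x\<close>.\<close>
  define clip where "clip t = max (- B) (min B t)" for t :: real
  have "continuous_on {- C..C} clip" unfolding clip_def by (intro continuous_intros)
  then obtain q where q: "real_polynomial_function q" and qC: "\<And>t. t \<in> {- C..C} \<Longrightarrow> \<bar>clip t - q t\<bar> < e"
    using Stone_Weierstrass_real_polynomial_function[of "{-C..C}" clip e] e by auto
  have q_close: "\<bar>clip (g x) - q (g x)\<bar> < e" for x
    using C[of x] by (intro qC) auto
  have "\<bar>f x - q (g x)\<bar> \<le> 2 * e" if "x \<in> K" for x
  proof -
    have "\<bar>f x - clip (g x)\<bar> \<le> \<bar>f x - g x\<bar>" using B[of x] by (auto simp: clip_def)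
    with gK[OF that] q_close[of x] show ?thesis by linarith
  qed
  moreover have "\<bar>f x - q (g x)\<bar> \<le> 2 * B + e" for x
  proof -
    have "\<bar>clip (g x)\<bar> \<le> B" using B[of x] by (auto simp: clip_def)
    with B[of x] q_close[of x] show ?thesis by linarith
  qed
  ultimately show ?thesis using multiplier_polynomial[OF q g] by blast
qed

section \<open>From compact sets to the whole space by tightness\<close>

lemma integral_diff_le:
  fixes P :: "'a measure"
  assumes "prob_space P" and f: "integrable P f" and g: "integrable P g" and K: "K \<in> sets P"
    and near: "\<And>x. x \<in> K \<Longrightarrow> \<bar>f x - g x\<bar> \<le> a" and far: "\<And>x. \<bar>f x - g x\<bar> \<le> b"
    and PK: "measure P (space P - K) \<le> e" and "0 \<le> a" "0 \<le> b"
  shows "\<bar>(\<integral>x. f x \<partial>P) - (\<integral>x. g x \<partial>P)\<bar> \<le> a + b * e"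
proof -
  interpret prob_space P by fact
  have "\<bar>(\<integral>x. f x \<partial>P) - (\<integral>x. g x \<partial>P)\<bar> = \<bar>\<integral>x. f x - g x \<partial>P\<bar>" using f g by simp
  also have "\<dots> \<le> (\<integral>x. \<bar>f x - g x\<bar> \<partial>P)" by (rule integral_abs_bound)
  also have "\<dots> \<le> (\<integral>x. a + b * indicator (space P - K) x \<partial>P)"
  proof (rule integral_mono)
    show "integrable P (\<lambda>x. \<bar>f x - g x\<bar>)" using f g by auto
    show "integrable P (\<lambda>x. a + b * indicator (space P - K) x)"
      using K by (intro Bochner_Integration.integrable_add integrable_mult_right integrable_real_indicator)
        (auto simp: less_top[symmetric])
    show "\<bar>f x - g x\<bar> \<le> a + b * indicator (space P - K) x" if "x \<in> space P" for x
      using near[of x] far[of x] that assms(8) by (cases "x \<in> K") auto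
  qed
  also have "\<dots> = a + b * measure P (space P - K)"
    using K by (subst Bochner_Integration.integral_add) (auto simp: prob_space less_top[symmetric])
  also have "\<dots> \<le> a + b * e" using PK assms(9) by (simp add: mult_left_mono)
  finally show ?thesis .
qed

text \<open>Compare the integrals of \<open>f\<close> with those of a multiplier \<open>g\<close>,
  once under \<open>M n\<close> and once under \<open>N\<close>; the integrals of \<open>g\<close>
  converge. Each comparison splits at \<open>K\<close>: \<open>g\<close> is close to
  \<open>f\<close> on \<open>K\<close>, and off \<open>K\<close> the difference is bounded while the
  mass is small.\<close>

theorem integral_convergence_of_tight:
  fixes f :: "'a \<Rightarrow> real"
  assumes f: "continuous_on UNIV f" and bf: "bounded_measurable f"
    and tight: "\<And>e. e > 0 \<Longrightarrow> \<exists>K. compact K \<and> (\<forall>x\<in>K. \<forall>y\<in>K. x \<noteq> y \<longrightarrow> (\<exists>l\<in>L. l x \<noteq> l y)) \<and>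
      (\<forall>n. K \<in> sets (M n)) \<and> K \<in> sets N \<and> (\<forall>\<^sub>F n in sequentially. measure (M n) (space (M n) - K) \<le> e) \<and>
      measure N (space N - K) \<le> e"
  shows "(\<lambda>n. \<integral>x. f x \<partial>M n) \<longlonglongrightarrow> (\<integral>x. f x \<partial>N)"
proof (rule LIMSEQ_I)
  fix r :: real assume r: "r > 0"
  obtain B0 where B0: "\<And>x. \<bar>f x\<bar> \<le> B0" using bf by (auto simp: bounded_measurable_def)
  define B where "B = max B0 1"
  have B: "\<bar>f x\<bar> \<le> B" "B \<ge> 1" for x using B0[of x] by (auto simp: B_def)
  \<comment> \<open>The comparison error is 2 e on \<open>K\<close> plus (2 B + e) times the mass e
    outside. With e at most 1 this is at most (2 B + 3) e, hence at most r / 4, and three such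
    errors stay below r.\<close>
  define e where "e = min 1 (r / (4 * (2 * B + 4)))"
  have "4 * (2 * B + 4) > 0" using B(2) by simp
  then have e: "e > 0" "e \<le> 1" "e * (4 * (2 * B + 4)) \<le> r"
    using r pos_le_divide_eq[of "4 * (2 * B + 4)" e r] by (auto simp: e_def)
  obtain K where K: "compact K" "\<forall>x\<in>K. \<forall>y\<in>K. x \<noteq> y \<longrightarrow> (\<exists>l\<in>L. l x \<noteq> l y)"
    "\<forall>n. K \<in> sets (M n)" "K \<in> sets N" "\<forall>\<^sub>F n in sequentially. measure (M n) (space (M n) - K) \<le> e"
    "measure N (space N - K) \<le> e"
    using tight[OF e(1)] by (elim exE conjE) (rule that)
  obtain g where g: "multiplier g" and near: "\<And>x. x \<in> K \<Longrightarrow> \<bar>f x - g x\<bar> \<le> 2 * e"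
    and far: "\<And>x. \<bar>f x - g x\<bar> \<le> 2 * B + e"
    using bounded_multiplier_approximation[OF f B(1) K(1) _ e(1)] K(2) by metis
  have bg: "bounded_measurable g" using g by (simp add: multiplier_def)
  have close: "\<bar>(\<integral>x. f x \<partial>P) - (\<integral>x. g x \<partial>P)\<bar> \<le> 2 * e + (2 * B + e) * e"
    if "P = N \<or> (\<exists>n. P = M n)" "measure P (space P - K) \<le> e" for P
    using that bf bg K(3,4) near far e B(2) prob_M prob_N
    by (intro integral_diff_le[where K=K]) (auto intro: bounded_measurable_integrable)
  have small: "2 * e + (2 * B + e) * e \<le> r / 4"
  proof -
    have "(2 * B + e) * e \<le> (2 * B + 1) * e" using e by (intro mult_right_mono) auto
    then have "2 * e + (2 * B + e) * e \<le> 2 * e + (2 * B + 1) * e" by simp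
    also have "\<dots> \<le> e * (4 * (2 * B + 4)) / 4" using e(1) by (simp add: algebra_simps)
    also have "\<dots> \<le> r / 4" using e(3) by simp
    finally show ?thesis .
  qed
  have "\<forall>\<^sub>F n in sequentially. dist (\<integral>x. g x \<partial>M n) (\<integral>x. g x \<partial>N) < r / 4"
    using multiplier_converges[OF g] r by (intro tendstoD) auto
  with K(5) have "\<forall>\<^sub>F n in sequentially. norm ((\<integral>x. f x \<partial>M n) - (\<integral>x. f x \<partial>N)) < r"
  proof eventually_elim
    case (elim n)
    have "\<bar>(\<integral>x. f x \<partial>M n) - (\<integral>x. g x \<partial>M n)\<bar> \<le> r / 4" using close[of "M n"] elim small by force
    moreover have "\<bar>(\<integral>x. f x \<partial>N) - (\<integral>x. g x \<partial>N)\<bar> \<le> r / 4" using close[of N] K(6) small by force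
    ultimately show ?case using elim(2) r unfolding dist_real_def real_norm_def by linarith
  qed
  then show "\<exists>no. \<forall>n\<ge>no. norm ((\<integral>x. f x \<partial>M n) - (\<integral>x. f x \<partial>N)) < r"
    by (simp add: eventually_sequentially)
qed

end

section \<open>Linear change of variables in the Lebesgue integral\<close>

lemma prod_Basis_cart: "(\<Prod>b\<in>(Basis :: (real ^ 'n) set). f b) = (\<Prod>i\<in>UNIV. f (axis i 1))"
proof -
  have B: "(Basis :: (real ^ 'n) set) = range (\<lambda>i. axis i 1)" by (auto simp: Basis_vec_def)
  have "inj (\<lambda>i::'n. axis i (1::real))" by (auto simp: inj_def axis_eq_axis)
  then show ?thesis unfolding B by (subst prod.reindex) auto
qed

lemma Ball_Basis_cart: "(\<forall>b\<in>(Basis :: (real ^ 'n) set). P b) \<longleftrightarrow> (\<forall>i. P (axis i 1))"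
  by (auto simp: Basis_vec_def)

lemma borel_measurable_vec_lambda:
  fixes f :: "'a \<Rightarrow> 'n::finite \<Rightarrow> real"
  assumes "\<And>i. (\<lambda>x. f x i) \<in> borel_measurable M"
  shows "(\<lambda>x. \<chi> i. f x i) \<in> borel_measurable M"
  by (subst borel_measurable_euclidean_space) (use assms in \<open>auto simp: Basis_vec_def inner_axis\<close>)

lemma borel_measurable_vec_nth [measurable]:
  "(\<lambda>x :: real ^ 'n. x $ i) \<in> borel_measurable borel"
  by (intro borel_measurable_continuous_onI continuous_intros)

lemma measurable_vec_lambda_PiM [measurable]:
  "(\<lambda>f. \<chi> i. f i) \<in> PiM (UNIV :: 'n::finite set) (\<lambda>_. lborel :: real measure) \<rightarrow>\<^sub>M borel"
  by (rule borel_measurable_vec_lambda) measurable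

text \<open>Lebesgue measure is determined by the volumes of boxes, and the preimage of a box is a
  product of intervals. This opens coordinatewise integration by Fubini's theorem.\<close>

lemma lborel_cart_eq_PiM:
  "(lborel :: (real ^ 'n) measure) = distr (PiM UNIV (\<lambda>_. lborel)) borel (\<lambda>f. \<chi> i. f i)"
proof (rule lborel_eqI)
  interpret product_sigma_finite "\<lambda>_::'n. lborel :: real measure" ..
  fix l u :: "real ^ 'n" assume le: "\<And>b. b \<in> Basis \<Longrightarrow> l \<bullet> b \<le> u \<bullet> b"
  have le': "l $ i \<le> u $ i" for i using le[of "axis i 1"] by (simp add: inner_axis axis_in_Basis_iff)
  have "(\<lambda>f. \<chi> i. f i) -` box l u \<inter> space (PiM UNIV (\<lambda>_::'n. lborel)) = PiE UNIV (\<lambda>i. box (l $ i) (u $ i))"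
    by (auto simp: mem_box_cart space_PiM PiE_iff simp del: box_real)
  then have "emeasure (distr (PiM UNIV (\<lambda>_. lborel)) borel (\<lambda>f. \<chi> i. f i)) (box l u)
      = (\<Prod>i\<in>UNIV. emeasure lborel (box (l $ i) (u $ i)))"
    by (simp add: emeasure_distr emeasure_PiM)
  also have "\<dots> = (\<Prod>i\<in>UNIV. ennreal (u $ i - l $ i))" using le' by (simp add: box_real)
  also have "\<dots> = (\<Prod>b\<in>Basis. (u - l) \<bullet> b)"
    using le' by (simp add: prod_Basis_cart inner_axis prod_ennreal)
  finally show "emeasure (distr (PiM UNIV (\<lambda>_. lborel)) borel (\<lambda>f. \<chi> i. f i)) (box l u) = (\<Prod>b\<in>Basis. (u - l) \<bullet> b)" .
qed simp

lemma nn_integral_lborel_cart: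
  fixes g :: "real ^ 'n \<Rightarrow> ennreal"
  assumes [measurable]: "g \<in> borel_measurable borel"
  shows "(\<integral>\<^sup>+x. g x \<partial>lborel) = (\<integral>\<^sup>+f. g (\<chi> i. f i) \<partial>PiM UNIV (\<lambda>_. lborel))"
  by (subst lborel_cart_eq_PiM) (simp add: nn_integral_distr)

text \<open>Exchanging two coordinates carries boxes to boxes with the same side lengths in another
  order, so it preserves Lebesgue measure.\<close>

lemma nn_integral_lborel_swap:
  fixes g :: "real ^ 'n \<Rightarrow> ennreal"
  assumes [measurable]: "g \<in> borel_measurable borel"
  shows "(\<integral>\<^sup>+x. g (\<chi> i. x $ Transposition.transpose m n i) \<partial>lborel) = (\<integral>\<^sup>+x. g x \<partial>lborel)"
proof -
  let ?s = "\<lambda>x :: real ^ 'n. \<chi> i. x $ Transposition.transpose m n i"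
  have [measurable]: "?s \<in> borel \<rightarrow>\<^sub>M borel"
    by (intro borel_measurable_continuous_onI continuous_intros)
  have "lborel = distr lborel borel ?s"
  proof (rule lborel_eqI)
    fix l u :: "real ^ 'n" assume le: "\<And>b. b \<in> Basis \<Longrightarrow> l \<bullet> b \<le> u \<bullet> b"
    have le': "l $ i \<le> u $ i" for i using le[of "axis i 1"] by (simp add: inner_axis axis_in_Basis_iff)
    have pre: "?s -` box l u = box (?s l) (?s u)"
      by (auto simp: mem_box_cart) (metis transpose_involutory)+
    have "(\<Prod>i\<in>UNIV. u $ Transposition.transpose m n i - l $ Transposition.transpose m n i) = (\<Prod>i\<in>UNIV. u $ i - l $ i)"
      by (rule prod.reindex_bij_betw[where g="\<lambda>i. u $ i - l $ i", OF bij_transpose])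
    then show "emeasure (distr lborel borel ?s) (box l u) = (\<Prod>b\<in>Basis. (u - l) \<bullet> b)"
      using le' by (simp add: emeasure_distr pre emeasure_lborel_box_eq prod_Basis_cart inner_axis
          inner_diff_left Ball_Basis_cart)
  qed simp
  then have "(\<integral>\<^sup>+x. g x \<partial>lborel) = (\<integral>\<^sup>+x. g x \<partial>distr lborel borel ?s)" by simp
  then show ?thesis by (simp add: nn_integral_distr)
qed

text \<open>Integrate over coordinate \<open>m\<close> innermost: with all other coordinates fixed,
  the shear is a translation of the line.\<close>

lemma nn_integral_lborel_shear:
  fixes g :: "real ^ 'n \<Rightarrow> ennreal"
  assumes [measurable]: "g \<in> borel_measurable borel" and "m \<noteq> n"
  shows "(\<integral>\<^sup>+x. g (\<chi> i. if i = m then x $ m + x $ n else x $ i) \<partial>lborel) = (\<integral>\<^sup>+x. g x \<partial>lborel)"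
proof -
  interpret product_sigma_finite "\<lambda>_::'n. lborel :: real measure" ..
  let ?s = "\<lambda>x :: real ^ 'n. \<chi> i. if i = m then x $ m + x $ n else x $ i"
  let ?P = "PiM (UNIV - {m}) (\<lambda>_::'n. lborel :: real measure)"
  have ms [measurable]: "?s \<in> borel \<rightarrow>\<^sub>M borel"
    by (rule borel_measurable_vec_lambda) auto
  have U: "UNIV = insert m (UNIV - {m})" by auto
  have split: "(\<integral>\<^sup>+x. h x \<partial>lborel) = (\<integral>\<^sup>+f. \<integral>\<^sup>+t. h (\<chi> i. (f(m := t)) i) \<partial>lborel \<partial>?P)"
    if [measurable]: "h \<in> borel_measurable borel" for h :: "real ^ 'n \<Rightarrow> ennreal"
  proof -
    have "(\<integral>\<^sup>+x. h x \<partial>lborel) = (\<integral>\<^sup>+f. h (\<chi> i. f i) \<partial>PiM (insert m (UNIV - {m})) (\<lambda>_. lborel))"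
      by (subst nn_integral_lborel_cart) (auto simp: U[symmetric])
    also have "\<dots> = (\<integral>\<^sup>+f. \<integral>\<^sup>+t. h (\<chi> i. (f(m := t)) i) \<partial>lborel \<partial>?P)"
      by (rule product_nn_integral_insert) (auto simp: U[symmetric])
    finally show ?thesis .
  qed
  have "(\<integral>\<^sup>+x. g (?s x) \<partial>lborel) = (\<integral>\<^sup>+f. \<integral>\<^sup>+t. g (?s (\<chi> i. (f(m := t)) i)) \<partial>lborel \<partial>?P)"
    by (rule split) measurable
  also have "\<dots> = (\<integral>\<^sup>+f. \<integral>\<^sup>+t. g (\<chi> i. (f(m := t)) i) \<partial>lborel \<partial>?P)"
  proof (rule nn_integral_cong)
    fix f :: "'n \<Rightarrow> real"
    have [measurable]: "(\<lambda>t. g (\<chi> i. (f(m := t)) i)) \<in> borel_measurable borel"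
    proof -
      have [measurable]: "(\<lambda>t. \<chi> i. (f(m := t)) i) \<in> borel \<rightarrow>\<^sub>M borel"
        by (rule borel_measurable_vec_lambda) auto
      show ?thesis by measurable
    qed
    \<comment> \<open>The shift \<open>f n\<close> does not depend on the integration variable,
      because \<open>n\<close> differs from \<open>m\<close>.\<close>
    have "(\<integral>\<^sup>+t. g (\<chi> i. (f(m := t)) i) \<partial>lborel) = (\<integral>\<^sup>+t. g (\<chi> i. (f(m := f n + 1 * t)) i) \<partial>lborel)"
      by (subst nn_integral_real_affine[where c=1 and t="f n"]) auto
    also have "\<dots> = (\<integral>\<^sup>+t. g (?s (\<chi> i. (f(m := t)) i)) \<partial>lborel)"
      using \<open>m \<noteq> n\<close> by (intro nn_integral_cong arg_cong[where f=g]) (auto simp: vec_eq_iff)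
    finally show "(\<integral>\<^sup>+t. g (?s (\<chi> i. (f(m := t)) i)) \<partial>lborel) = (\<integral>\<^sup>+t. g (\<chi> i. (f(m := t)) i) \<partial>lborel)" ..
  qed
  also have "\<dots> = (\<integral>\<^sup>+x. g x \<partial>lborel)" by (rule split[symmetric]) measurable
  finally show ?thesis .
qed

lemma nn_integral_lborel_diagonal:
  fixes g :: "real ^ 'n \<Rightarrow> ennreal"
  assumes [measurable]: "g \<in> borel_measurable borel" and c: "\<And>i. c i \<noteq> 0"
  shows "ennreal (\<Prod>i\<in>UNIV. \<bar>c i\<bar>) * (\<integral>\<^sup>+x. g (\<chi> i. c i * x $ i) \<partial>lborel) = (\<integral>\<^sup>+x. g x \<partial>lborel)"
proof -
  \<comment> \<open>The affine change of variables takes its factors indexed by basis vectors; this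
    linear form returns \<open>c i\<close> at the basis vector \<open>axis i 1\<close>.\<close>
  define d where "d b = (\<Sum>i\<in>UNIV. c i * b $ i)" for b :: "real ^ 'n"
  have d: "d (axis i 1) = c i" for i by (simp add: d_def axis_def if_distrib cong: if_cong)
  have d0: "d b \<noteq> 0" if "b \<in> Basis" for b using that c by (auto simp: Basis_vec_def d)
  have eq: "0 + (\<Sum>j\<in>Basis. (d j * (x \<bullet> j)) *\<^sub>R j) = (\<chi> i. c i * x $ i)" for x :: "real ^ 'n"
  proof (rule vec_eq_iff[THEN iffD2], rule allI)
    fix i
    have B: "axis i 1 \<in> (Basis :: (real ^ 'n) set)" by (simp add: axis_in_Basis_iff)
    have "(0 + (\<Sum>j\<in>Basis. (d j * (x \<bullet> j)) *\<^sub>R j)) \<bullet> axis i 1 = d (axis i 1) * (x \<bullet> axis i 1)"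
      using B by (simp add: inner_sum_left_Basis)
    then show "(0 + (\<Sum>j\<in>Basis. (d j * (x \<bullet> j)) *\<^sub>R j)) $ i = (\<chi> i. c i * x $ i) $ i"
      by (simp add: d inner_axis)
  qed
  have [measurable]: "(\<lambda>x :: real ^ 'n. \<chi> i. c i * x $ i) \<in> borel \<rightarrow>\<^sub>M borel"
    by (rule borel_measurable_vec_lambda) auto
  have "(\<integral>\<^sup>+x. g x \<partial>lborel) = (\<integral>\<^sup>+x. g x \<partial>density (distr lborel borel (\<lambda>x. \<chi> i. c i * x $ i)) (\<lambda>_. (\<Prod>j\<in>Basis. \<bar>d j\<bar>)))"
    using lborel_affine_euclidean[where t=0 and c=d, OF d0] unfolding eq by simp
  also have "\<dots> = ennreal (\<Prod>i\<in>UNIV. \<bar>c i\<bar>) * (\<integral>\<^sup>+x. g (\<chi> i. c i * x $ i) \<partial>lborel)"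
    by (simp add: nn_integral_density nn_integral_distr nn_integral_cmult prod_Basis_cart d)
  finally show ?thesis ..
qed

text \<open>The change of variables formula of the library requires a well-ordered index type, which
  \<open>'p option\<close> is not.\<close>

theorem nn_integral_lborel_linear:
  fixes A :: "real ^ 'n ^ 'n"
  assumes "det A \<noteq> 0" "g \<in> borel_measurable borel"
  shows "ennreal \<bar>det A\<bar> * (\<integral>\<^sup>+x. g (A *v x) \<partial>lborel) = (\<integral>\<^sup>+x. g x \<partial>lborel)"
  using assms
\<comment> \<open>Matrices are generated by products from matrices with a zero row, diagonal
  matrices, coordinate swaps and shears. A zero row contradicts the nonzero determinant; the last
  three kinds are the integral formulas just proved. The function \<open>g\<close> must vary because
  the product case applies the formula to the composite of \<open>g\<close> with a factor.\<close>
proof (induction A arbitrary: g rule: induct_matrix_elementary_alt)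
  case (1 A B)
  have [measurable]: "(\<lambda>x. g (A *v x)) \<in> borel_measurable borel"
    by (rule measurable_compose[OF _ 1(4)]) (intro borel_measurable_continuous_onI continuous_intros)
  have "ennreal \<bar>det (A ** B)\<bar> * (\<integral>\<^sup>+x. g ((A ** B) *v x) \<partial>lborel)
    = ennreal \<bar>det A\<bar> * (ennreal \<bar>det B\<bar> * (\<integral>\<^sup>+x. g (A *v (B *v x)) \<partial>lborel))"
    by (simp add: det_mul abs_mult ennreal_mult mult.assoc matrix_vector_mul_assoc)
  also have "ennreal \<bar>det B\<bar> * (\<integral>\<^sup>+x. g (A *v (B *v x)) \<partial>lborel) = (\<integral>\<^sup>+x. g (A *v x) \<partial>lborel)"
    using 1(2)[of "\<lambda>x. g (A *v x)"] 1(3) by (simp add: det_mul)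
  also have "ennreal \<bar>det A\<bar> * (\<integral>\<^sup>+x. g (A *v x) \<partial>lborel) = (\<integral>\<^sup>+x. g x \<partial>lborel)"
    using 1 by (simp add: det_mul)
  finally show ?case .
next
  case (2 A i)
  then show ?case using det_zero_row(1)[of i A] by simp
next
  case (3 A)
  have dA: "det A = (\<Prod>i\<in>UNIV. A $ i $ i)" using 3(1) by (intro det_diagonal) auto
  have "(A *v x) $ i = A $ i $ i * x $ i" for x i
  proof -
    have "(A *v x) $ i = (\<Sum>j\<in>UNIV. if j = i then A $ i $ i * x $ i else 0)"
      unfolding matrix_vector_mult_def vec_lambda_beta by (rule sum.cong) (use 3(1) in auto)
    then show ?thesis by simp
  qed
  then have "A *v x = (\<chi> i. A $ i $ i * x $ i)" for x by (simp add: vec_eq_iff)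
  then show ?case
    using nn_integral_lborel_diagonal[OF 3(3), of "\<lambda>i. A $ i $ i"] 3(2) by (simp add: dA abs_prod)
next
  case (4 m n)
  let ?A = "\<chi> i j. mat 1 $ i $ Transposition.transpose m n j :: real ^ 'n ^ 'n"
  have "det ?A = of_int (sign (Transposition.transpose m n)) * det (mat 1 :: real ^ 'n ^ 'n)"
    by (rule det_permute_columns) (simp add: permutes_swap_id)
  then have "\<bar>det ?A\<bar> = 1" by (simp add: sign_swap_id 4)
  moreover have "?A *v x = (\<chi> i. x $ Transposition.transpose m n i)" for x
  proof -
    have "(?A *v x) $ i = x $ Transposition.transpose m n i" for i
    proof -
      have eq: "i = Transposition.transpose m n j \<longleftrightarrow> j = Transposition.transpose m n i" for j
        by (metis transpose_involutory)
      have "(?A *v x) $ i = (\<Sum>j\<in>UNIV. if j = Transposition.transpose m n i then x $ j else 0)"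
        unfolding matrix_vector_mult_def mat_def vec_lambda_beta
        by (rule sum.cong[OF refl]) (simp add: eq)
      then show ?thesis by simp
    qed
    then show ?thesis by (simp add: vec_eq_iff)
  qed
  ultimately show ?case using nn_integral_lborel_swap[OF 4(3)] by simp
next
  case (5 m n)
  let ?A = "\<chi> i j. of_bool (i = m \<and> j = n \<or> i = j) :: real ^ 'n ^ 'n"
  have "?A = (\<chi> k. if k = m then row m (mat 1) + 1 *s row n (mat 1) else row k (mat 1))"
    using 5(1) by (auto simp: vec_eq_iff row_def mat_def)
  then have "det ?A = det (mat 1 :: real ^ 'n ^ 'n)"
    using det_row_operation[OF 5(1), of "mat 1 :: real ^ 'n ^ 'n" 1] by simp
  moreover have "?A *v x = (\<chi> i. if i = m then x $ m + x $ n else x $ i)" for x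
  proof -
    have "(?A *v x) $ i = (if i = m then x $ m + x $ n else x $ i)" for i
    proof -
      have "(?A *v x) $ i = (\<Sum>j\<in>UNIV. (if j = i then x $ j else 0) + (if j = n then (if i = m then x $ j else 0) else 0))"
        unfolding matrix_vector_mult_def using 5(1) by (auto intro!: sum.cong)
      then show ?thesis by (simp add: sum.distrib)
    qed
    then show ?thesis by (simp add: vec_eq_iff)
  qed
  ultimately show ?case using nn_integral_lborel_shear[OF 5(3) 5(1)] by simp
qed

section \<open>Characteristic function of the multivariate normal law\<close>

lemma inner_symmetric_matrix:
  fixes S :: "real ^ 'd ^ 'd"
  assumes "transpose S = S"
  shows "u \<bullet> (S *v x) = x \<bullet> (S *v u)"
proof -
  have "u \<bullet> (S *v x) = (transpose S *v u) \<bullet> x" by (simp add: dot_lmul_matrix)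
  then show ?thesis using assms by (simp add: inner_commute)
qed

text \<open>Gram-Schmidt for the inner product \<open>u \<bullet> (S *v v)\<close>.\<close>

lemma positive_definite_orthonormal_family:
  fixes S :: "real ^ 'd ^ 'd"
  assumes S: "positive_definite S"
  shows "n \<le> CARD('d) \<Longrightarrow> \<exists>B. finite B \<and> card B = n \<and> (\<forall>u\<in>B. \<forall>v\<in>B. u \<bullet> (S *v v) = of_bool (u = v))"
proof (induction n)
  case 0
  then show ?case by (intro exI[of _ "{}"]) auto
next
  case (Suc n)
  then obtain B where B: "finite B" "card B = n" "\<And>u v. u \<in> B \<Longrightarrow> v \<in> B \<Longrightarrow> u \<bullet> (S *v v) = of_bool (u = v)"
    by auto
  \<comment> \<open>Fewer than CARD('d) vectors leave a nonzero direction orthogonal to all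
    \<open>S *v u\<close> with \<open>u\<close> in \<open>B\<close>. It is orthogonal to
    \<open>B\<close> for the form given by \<open>S\<close> and only has to be normalised.\<close>
  have "dim ((*v) S ` B) \<le> card ((*v) S ` B)" using B by (intro dim_le_card') auto
  also have "\<dots> \<le> n" using B card_image_le by blast
  finally have "dim ((*v) S ` B) < DIM(real ^ 'd)" using Suc.prems by simp
  then obtain x where x: "x \<noteq> 0" "\<And>w. w \<in> span ((*v) S ` B) \<Longrightarrow> orthogonal x w"
    using orthogonal_to_subspace_exists[of "(*v) S ` B"] by blast
  have xS: "x \<bullet> (S *v x) > 0" using S x(1) by (auto simp: positive_definite_def)
  define v where "v = (1 / sqrt (x \<bullet> (S *v x))) *\<^sub>R x"
  have sym: "transpose S = S" using S by (auto simp: positive_definite_def)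
  have xu: "x \<bullet> (S *v u) = 0" if "u \<in> B" for u
    using x(2)[of "S *v u"] that by (auto simp: orthogonal_def span_base)
  then have vu: "v \<bullet> (S *v u) = 0" "u \<bullet> (S *v v) = 0" if "u \<in> B" for u
    using that inner_symmetric_matrix[OF sym, of u v] by (simp_all add: v_def)
  have vv: "v \<bullet> (S *v v) = 1"
    using xS by (simp add: v_def matrix_vector_mult_scaleR)
  have "v \<notin> B" using vv vu by force
  then show ?case
    using B vu vv by (intro exI[of _ "insert v B"]) auto
qed

text \<open>The columns of \<open>E\<close> are an orthonormal family of full size for the form
  given by \<open>S\<close>; the entries of the product are its values on pairs of columns.\<close>

lemma positive_definite_whitening:
  fixes S :: "real ^ 'd ^ 'd"
  assumes S: "positive_definite S"
  shows "\<exists>E :: real ^ 'd ^ 'd. transpose E ** (S ** E) = mat 1"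
proof -
  obtain B where B: "finite B" "card B = CARD('d)" "\<And>u v. u \<in> B \<Longrightarrow> v \<in> B \<Longrightarrow> u \<bullet> (S *v v) = of_bool (u = v)"
    using positive_definite_orthonormal_family[OF S order_refl] by auto
  obtain h where h: "bij_betw h (UNIV :: 'd set) B"
    using finite_same_card_bij[OF _ B(1), of "UNIV :: 'd set"] B(2) by auto
  define E where "E = (\<chi> i j. h j $ i)"
  have "(transpose E ** (S ** E)) $ i $ j = mat 1 $ i $ j" for i j
  proof -
    have "(transpose E ** (S ** E)) $ i $ j = h i \<bullet> (S *v h j)"
      by (simp add: E_def matrix_matrix_mult_def matrix_vector_mult_def transpose_def inner_vec_def)
    also have "\<dots> = of_bool (h i = h j)" using h by (intro B) (auto simp: bij_betw_def)
    also have "\<dots> = mat 1 $ i $ j" using h by (auto simp: mat_def bij_betw_def inj_def)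
    finally show ?thesis .
  qed
  then show ?thesis by (auto simp: vec_eq_iff)
qed

text \<open>With the whitening matrix \<open>E\<close> put A = S E. Then E^T is the inverse of A,
  which yields both A A^T = S and S^(-1) = E E^T. The third conclusion says that x = A u turns the
  exponent of the normal density into the standard one.\<close>

lemma positive_definite_factorization:
  fixes S :: "real ^ 'd ^ 'd"
  assumes S: "positive_definite S"
  obtains A :: "real ^ 'd ^ 'd" where "det A \<noteq> 0" "A ** transpose A = S"
    "\<And>u. (A *v u) \<bullet> (matrix_inv S *v (A *v u)) = u \<bullet> u"
proof -
  obtain E :: "real ^ 'd ^ 'd" where E: "transpose E ** (S ** E) = mat 1"
    using positive_definite_whitening[OF S] by auto
  define A where "A = S ** E"
  have sym: "transpose S = S" using S by (auto simp: positive_definite_def)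
  have tA: "transpose A = transpose E ** S" by (simp add: A_def matrix_transpose_mul sym)
  have EA: "transpose E ** A = mat 1" using E by (simp add: A_def)
  then have AE: "A ** transpose E = mat 1" by (simp add: matrix_left_right_inverse)
  have "transpose A ** E = mat 1" using E by (simp add: tA matrix_mul_assoc)
  then have EtA: "E ** transpose A = mat 1" by (simp add: matrix_left_right_inverse)
  have AA: "A ** transpose A = S"
  proof -
    have "A ** transpose A = S ** (E ** transpose A)" by (simp add: A_def matrix_mul_assoc)
    then show ?thesis by (simp add: EtA)
  qed
  have Sinv: "S ** (E ** transpose E) = mat 1" using AE by (simp add: A_def matrix_mul_assoc)
  then have "(E ** transpose E) ** S = mat 1" by (simp add: matrix_left_right_inverse)
  \<comment> \<open>\<open>matrix_inv\<close> is a choice among two-sided inverses, so a witness for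
    both equations comes first; only then is the chosen matrix known to satisfy them, and uniqueness
    identifies it with \<open>E ** transpose E\<close>.\<close>
  with Sinv have "S ** (E ** transpose E) = mat 1 \<and> (E ** transpose E) ** S = mat 1" by (rule conjI)
  then have "S ** matrix_inv S = mat 1 \<and> matrix_inv S ** S = mat 1"
    unfolding matrix_inv_def by (rule someI)
  then have "matrix_inv S ** S = mat 1" by simp
  have inv: "matrix_inv S = E ** transpose E"
  proof -
    have "matrix_inv S = matrix_inv S ** (S ** (E ** transpose E))" unfolding Sinv by (simp only: matrix_mul_rid)
    also have "\<dots> = (matrix_inv S ** S) ** (E ** transpose E)" by (simp only: matrix_mul_assoc)
    also have "\<dots> = E ** transpose E"
      unfolding \<open>matrix_inv S ** S = mat 1\<close> by (simp only: matrix_mul_lid)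
    finally show ?thesis .
  qed
  have "det (transpose E ** A) = 1" by (simp add: EA)
  then have "det A \<noteq> 0" by (auto simp: det_mul)
  moreover have "(A *v u) \<bullet> (matrix_inv S *v (A *v u)) = u \<bullet> u" for u
  proof -
    have "matrix_inv S *v (A *v u) = E *v u"
    proof -
      have "matrix_inv S *v (A *v u) = E *v (transpose E *v (A *v u))"
        by (simp add: inv matrix_vector_mul_assoc matrix_mul_assoc del: transpose_matrix_vector)
      also have "transpose E *v (A *v u) = u"
        using EA by (simp add: matrix_vector_mul_assoc del: transpose_matrix_vector)
      finally show ?thesis .
    qed
    moreover have "(A *v u) \<bullet> (E *v u) = (transpose E *v (A *v u)) \<bullet> u"
      by (simp add: dot_lmul_matrix)
    moreover have "transpose E *v (A *v u) = u"
      using EA by (simp add: matrix_vector_mul_assoc del: transpose_matrix_vector)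
    ultimately show ?thesis by simp
  qed
  ultimately show ?thesis using that AA by blast
qed

section \<open>The standard Gaussian and its linear images\<close>

text \<open>The product form of the density lets both the total mass and the characteristic function
  factor over the coordinates.\<close>

definition std_gaussian :: "(real ^ 'd) measure" where
  "std_gaussian = density lborel (\<lambda>u. ennreal (\<Prod>i\<in>UNIV. std_normal_density (u $ i)))"

lemma sets_std_gaussian [simp, measurable_cong]: "sets std_gaussian = sets borel"
  by (simp add: std_gaussian_def)

lemma space_std_gaussian [simp]: "space std_gaussian = UNIV"
  by (simp add: std_gaussian_def)

lemma prob_space_std_gaussian: "prob_space (std_gaussian :: (real ^ 'd) measure)"
proof
  interpret product_sigma_finite "\<lambda>_::'d. lborel :: real measure" ..
  have "emeasure (std_gaussian :: (real ^ 'd) measure) UNIV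
      = (\<integral>\<^sup>+f. (\<Prod>i\<in>(UNIV::'d set). ennreal (std_normal_density (f i))) \<partial>PiM UNIV (\<lambda>_. lborel))"
    by (simp add: std_gaussian_def emeasure_density nn_integral_lborel_cart prod_ennreal)
  also have "\<dots> = (\<Prod>i\<in>(UNIV::'d set). \<integral>\<^sup>+x. ennreal (std_normal_density x) \<partial>lborel)"
    by (rule product_nn_integral_prod) auto
  also have "(\<integral>\<^sup>+x. ennreal (std_normal_density x) \<partial>lborel) = 1"
    using prob_space.emeasure_space_1[OF prob_space_normal_density[of 1 0]]
    by (simp add: emeasure_density)
  finally show "emeasure (std_gaussian :: (real ^ 'd) measure) (space std_gaussian) = 1" by simp
qed

lemma char_std_gaussian:
  fixes t :: "real ^ 'd"
  shows "(\<integral>u. iexp (t \<bullet> u) \<partial>std_gaussian) = complex_of_real (exp (- (t \<bullet> t) / 2))"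
proof -
  interpret product_sigma_finite "\<lambda>_::'d. lborel :: real measure" ..
  interpret std: prob_space std_normal_distribution by (rule prob_space_normal_density) simp
  have one: "(\<integral>x. std_normal_density x *\<^sub>R iexp (s * x) \<partial>lborel) = complex_of_real (exp (- (s^2) / 2))" for s
    using fun_cong[OF char_std_normal_distribution, of s]
    by (simp add: char_def integral_density)
  have int: "integrable lborel (\<lambda>x. std_normal_density x *\<^sub>R iexp (s * x))" for s
  proof -
    have "integrable std_normal_distribution (\<lambda>x. iexp (s * x))"
      by (rule std.integrable_const_bound[where B=1]) auto
    then show ?thesis by (subst (asm) integrable_density) auto
  qed
  have meas [measurable]: "(\<lambda>u::real^'d. iexp (t \<bullet> u)) \<in> borel_measurable borel"
    by (intro borel_measurable_continuous_onI continuous_intros)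
  have "(\<integral>u. iexp (t \<bullet> u) \<partial>std_gaussian) = (\<integral>u. (\<Prod>i\<in>UNIV. std_normal_density (u $ i)) *\<^sub>R iexp (t \<bullet> u) \<partial>lborel)"
    unfolding std_gaussian_def by (subst integral_density) (auto intro!: prod_nonneg)
  also have "\<dots> = (\<integral>f. (\<Prod>i\<in>UNIV. std_normal_density (f i)) *\<^sub>R iexp (t \<bullet> (\<chi> i. f i)) \<partial>PiM UNIV (\<lambda>_. lborel))"
    by (subst lborel_cart_eq_PiM) (simp add: integral_distr)
  also have "\<dots> = (\<integral>f. (\<Prod>i\<in>UNIV. std_normal_density (f i) *\<^sub>R iexp (t $ i * f i)) \<partial>PiM UNIV (\<lambda>_. lborel))"
    by (intro Bochner_Integration.integral_cong refl)
      (simp add: scaleR_conv_of_real prod.distrib inner_vec_def sum_distrib_left exp_sum)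
  also have "\<dots> = (\<Prod>i\<in>UNIV. \<integral>x. std_normal_density x *\<^sub>R iexp (t $ i * x) \<partial>lborel)"
    by (rule product_integral_prod[OF finite int])
  also have "\<dots> = complex_of_real (exp (- (t \<bullet> t) / 2))"
  proof -
    have "(\<Prod>i\<in>UNIV. exp (- ((t $ i)\<^sup>2) / 2)) = exp (- (t \<bullet> t) / 2)"
      by (simp add: inner_vec_def power2_eq_square sum_divide_distrib sum_negf flip: exp_sum)
    then show ?thesis unfolding one by (simp only: of_real_prod[symmetric])
  qed
  finally show ?thesis .
qed

text \<open>Substitute x = A u. Since det S = (det A)^2, the normalising constant of the density
  contains |det A|, which cancels the Jacobian and leaves the product of standard normal
  densities.\<close>

lemma mv_normal_eq_distr:
  fixes S :: "real ^ 'd ^ 'd"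
  assumes A: "det A \<noteq> 0" "A ** transpose A = S"
    "\<And>u. (A *v u) \<bullet> (matrix_inv S *v (A *v u)) = u \<bullet> u"
  shows "mv_normal S = distr std_gaussian borel ((*v) A)"
proof (rule measure_eqI)
  fix X assume "X \<in> sets (mv_normal S)"
  then have [measurable]: "X \<in> sets borel" by (simp add: mv_normal_def)
  define D where "D x = exp (- (x \<bullet> (matrix_inv S *v x)) / 2) / sqrt ((2 * pi) ^ CARD('d) * det S)" for x
  have [measurable]: "(*v) M \<in> borel \<rightarrow>\<^sub>M borel" for M :: "real ^ 'd ^ 'd"
    by (intro borel_measurable_continuous_onI continuous_intros)
  have [measurable]: "D \<in> borel_measurable borel"
    unfolding D_def by (intro borel_measurable_continuous_onI continuous_intros)
      (use A in \<open>auto simp: det_mul\<close>)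
  have D_A: "\<bar>det A\<bar> * D (A *v u) = (\<Prod>i\<in>UNIV. std_normal_density (u $ i))" for u
  proof -
    have "det S = (det A)\<^sup>2" using A(2) by (auto simp: det_mul power2_eq_square)
    then have "sqrt ((2 * pi) ^ CARD('d) * det S) = sqrt ((2 * pi) ^ CARD('d)) * sqrt ((det A)\<^sup>2)"
      by (simp only: real_sqrt_mult)
    also have "\<dots> = sqrt (2 * pi) ^ CARD('d) * \<bar>det A\<bar>"
      by (simp only: real_sqrt_power[of "2 * pi"] real_sqrt_abs)
    finally have "sqrt ((2 * pi) ^ CARD('d) * det S) = sqrt (2 * pi) ^ CARD('d) * \<bar>det A\<bar>" .
    then have "\<bar>det A\<bar> * D (A *v u) = exp (- (u \<bullet> u) / 2) / sqrt (2 * pi) ^ CARD('d)"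
      using A by (simp add: D_def)
    also have "\<dots> = (\<Prod>i\<in>UNIV. std_normal_density (u $ i))"
      by (simp add: std_normal_density_def prod_dividef inner_vec_def power2_eq_square sum_divide_distrib sum_negf
          flip: exp_sum)
    finally show ?thesis .
  qed
  have "mv_normal S = density lborel (\<lambda>x. ennreal (D x))" by (simp only: mv_normal_def D_def)
  then have "emeasure (mv_normal S) X = (\<integral>\<^sup>+x. ennreal (D x) * indicator X x \<partial>lborel)"
    by (simp add: emeasure_density)
  also have "\<dots> = ennreal \<bar>det A\<bar> * (\<integral>\<^sup>+u. ennreal (D (A *v u)) * indicator X (A *v u) \<partial>lborel)"
    by (rule nn_integral_lborel_linear[OF A(1), symmetric]) measurable
  also have "\<dots> = (\<integral>\<^sup>+u. ennreal (\<bar>det A\<bar> * D (A *v u)) * indicator X (A *v u) \<partial>lborel)"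
    by (subst nn_integral_cmult[symmetric]) (auto simp: ennreal_mult' mult.assoc)
  also have "\<dots> = emeasure (distr std_gaussian borel ((*v) A)) X"
    unfolding D_A std_gaussian_def
    by (simp add: emeasure_distr emeasure_density indicator_vimage[symmetric] indicator_def vimage_def)
  finally show "emeasure (mv_normal S) X = emeasure (distr std_gaussian borel ((*v) A)) X" .
qed (simp add: mv_normal_def)

lemma sets_mv_normal [simp, measurable_cong]: "sets (mv_normal S) = sets borel"
  by (simp add: mv_normal_def)

lemma space_mv_normal [simp]: "space (mv_normal S) = UNIV"
  by (simp add: mv_normal_def)

text \<open>Both claims are pulled back along A with A A^T = S: t . (A u) = (A^T t) . u, and the
  squared length of A^T t is t . (S t).\<close>

lemma
  fixes S :: "real ^ 'd ^ 'd"
  assumes S: "positive_definite S"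
  shows prob_space_mv_normal: "prob_space (mv_normal S)"
    and char_mv_normal: "(\<integral>x. iexp (t \<bullet> x) \<partial>mv_normal S) = complex_of_real (exp (- (t \<bullet> (S *v t)) / 2))"
proof -
  obtain A where A: "det A \<noteq> 0" "A ** transpose A = S"
    "\<And>u. (A *v u) \<bullet> (matrix_inv S *v (A *v u)) = u \<bullet> u"
    using positive_definite_factorization[OF S] by blast
  note eq = mv_normal_eq_distr[OF A]
  interpret prob_space "std_gaussian :: (real ^ 'd) measure" by (rule prob_space_std_gaussian)
  have [measurable]: "(*v) A \<in> borel \<rightarrow>\<^sub>M borel" "(\<lambda>x. iexp (t \<bullet> x)) \<in> borel_measurable borel"
    by (intro borel_measurable_continuous_onI continuous_intros)+
  show "prob_space (mv_normal S)" unfolding eq by (rule prob_space_distr) simp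
  have dot: "t \<bullet> (A *v u) = (transpose A *v t) \<bullet> u" for u by (simp add: dot_lmul_matrix)
  have "(\<integral>x. iexp (t \<bullet> x) \<partial>mv_normal S) = (\<integral>u. iexp ((transpose A *v t) \<bullet> u) \<partial>std_gaussian)"
    unfolding eq by (subst integral_distr) (auto simp: dot)
  also have "\<dots> = complex_of_real (exp (- ((transpose A *v t) \<bullet> (transpose A *v t)) / 2))"
    by (rule char_std_gaussian)
  also have "(transpose A *v t) \<bullet> (transpose A *v t) = t \<bullet> (S *v t)"
    unfolding dot[symmetric] A(2)[symmetric] by (simp add: matrix_vector_mul_assoc del: transpose_matrix_vector)
  finally show "(\<integral>x. iexp (t \<bullet> x) \<partial>mv_normal S) = complex_of_real (exp (- (t \<bullet> (S *v t)) / 2))" .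
qed

section \<open>Products of cosines and expectations over product distributions\<close>

text \<open>Real part of the third-order Taylor estimate for exp(iu). The cubic term is imaginary,
  so the remainder of order four applies to a quadratic polynomial.\<close>

lemma cos_quadratic_approx: "\<bar>cos u - (1 - u\<^sup>2 / 2)\<bar> \<le> u ^ 4 / 24" for u :: real
proof -
  have "cmod (iexp u - (\<Sum>j\<le>3. (\<i> * u) ^ j / fact j)) \<le> \<bar>u\<bar> ^ Suc 3 / fact (Suc 3)"
    by (rule iexp_approx1)
  then have "\<bar>Re (iexp u - (\<Sum>j\<le>3. (\<i> * u) ^ j / fact j))\<bar> \<le> \<bar>u\<bar> ^ Suc 3 / fact (Suc 3)"
    using abs_Re_le_cmod order_trans by blast
  moreover have "Re (iexp u - (\<Sum>j\<le>3. (\<i> * u) ^ j / fact j)) = cos u - (1 - u\<^sup>2 / 2)"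
    by (simp add: numeral_3_eq_3 fact_numeral Re_exp power2_eq_square)
  moreover have "\<bar>u\<bar> ^ Suc 3 / fact (Suc 3) = u ^ 4 / 24"
    by (simp add: fact_numeral eval_nat_numeral)
  ultimately show ?thesis by (simp only:)
qed

lemma exp_minus_linear_approx: "\<bar>exp (- x) - (1 - x)\<bar> \<le> x\<^sup>2" if "x \<ge> 0" for x :: real
proof -
  have "exp (- x) \<le> 1 / (1 + x)"
    using exp_ge_add_one_self[of x] that by (simp add: exp_minus field_simps)
  also have "\<dots> \<le> 1 - x + x\<^sup>2"
  proof -
    have "(1 - x + x\<^sup>2) * (1 + x) = 1 + x ^ 3" by (simp add: algebra_simps power2_eq_square power3_eq_cube)
    then show ?thesis using that by (simp add: divide_le_eq)
  qed
  finally show ?thesis using exp_ge_add_one_self[of "- x"] by (simp add: abs_if)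
qed

text \<open>Here x is half the mean of the squares, so x is at most \<delta> / 2. The mean cosine
  and exp(-x) both agree with 1 - x, up to \<delta> x / 12 and \<delta> x / 2 respectively, and
  these errors add up to less than the stated bound.\<close>

lemma mean_cos_approx:
  fixes s :: "'i \<Rightarrow> real"
  assumes "finite I" "I \<noteq> {}" and \<delta>: "\<And>i. i \<in> I \<Longrightarrow> (s i)\<^sup>2 \<le> \<delta>"
    and x: "x = (\<Sum>i\<in>I. (s i)\<^sup>2) / (2 * real (card I))"
  shows "\<bar>(\<Sum>i\<in>I. cos (s i)) / real (card I) - exp (- x)\<bar> \<le> \<delta> * x"
proof -
  define c where "c = real (card I)"
  have c: "c > 0" using assms(1,2) by (simp add: c_def card_gt_0_iff)
  have x0: "x \<ge> 0" by (simp add: x sum_nonneg)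
  have x\<delta>: "x \<le> \<delta> / 2"
  proof -
    have "(\<Sum>i\<in>I. (s i)\<^sup>2) \<le> c * \<delta>" using sum_bounded_above[of I "\<lambda>i. (s i)\<^sup>2" \<delta>] \<delta> by (simp add: c_def)
    then show ?thesis using c by (simp add: x flip: c_def) (simp add: field_simps)
  qed
  have "(\<Sum>i\<in>I. cos (s i)) / c - (1 - x) = (\<Sum>i\<in>I. cos (s i) - (1 - (s i)\<^sup>2 / 2)) / c"
    using c by (simp add: x sum_subtractf diff_divide_distrib add_divide_distrib flip: c_def sum_divide_distrib)
  also have "\<bar>\<dots>\<bar> \<le> (\<Sum>i\<in>I. \<delta> * (s i)\<^sup>2 / 24) / c"
  proof -
    have "\<bar>\<Sum>i\<in>I. cos (s i) - (1 - (s i)\<^sup>2 / 2)\<bar> \<le> (\<Sum>i\<in>I. \<delta> * (s i)\<^sup>2 / 24)"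
    proof (rule order_trans[OF sum_abs sum_mono])
      fix i assume "i \<in> I"
      then have "(s i)\<^sup>2 * (s i)\<^sup>2 \<le> \<delta> * (s i)\<^sup>2" using \<delta> by (intro mult_right_mono) auto
      then show "\<bar>cos (s i) - (1 - (s i)\<^sup>2 / 2)\<bar> \<le> \<delta> * (s i)\<^sup>2 / 24"
        using cos_quadratic_approx[of "s i"] by (simp flip: power_add)
    qed
    then show ?thesis using c by (simp add: divide_right_mono)
  qed
  also have "\<dots> = \<delta> * x / 12"
    using c by (simp add: x flip: c_def sum_divide_distrib sum_distrib_left)
  finally have 1: "\<bar>(\<Sum>i\<in>I. cos (s i)) / c - (1 - x)\<bar> \<le> \<delta> * x / 12" .
  have "\<bar>exp (- x) - (1 - x)\<bar> \<le> x * x"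
    using exp_minus_linear_approx[OF x0] by (simp add: power2_eq_square)
  also have "\<dots> \<le> \<delta> / 2 * x" using x\<delta> x0 by (intro mult_right_mono)
  finally have 2: "\<bar>exp (- x) - (1 - x)\<bar> \<le> \<delta> / 2 * x" .
  have "\<delta> * x \<ge> 0" using x0 x\<delta> by simp
  with 1 2 show ?thesis unfolding c_def by linarith
qed

text \<open>For factors of modulus at most 1, a difference of products is at most the sum of the
  differences of the factors. The mean over \<open>I\<close> covers both sketches: \<open>I\<close>
  is the set of sketch rows for Clarkson-Woodruff and a single point for Hadamard.\<close>

lemma prod_mean_cos_approx:
  fixes s :: "'j \<Rightarrow> 'i \<Rightarrow> real"
  assumes "finite I" "I \<noteq> {}" "\<And>j i. j \<in> J \<Longrightarrow> i \<in> I \<Longrightarrow> (s j i)\<^sup>2 \<le> \<delta>"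
  shows "\<bar>(\<Prod>j\<in>J. (\<Sum>i\<in>I. cos (s j i)) / real (card I)) - exp (- (\<Sum>j\<in>J. \<Sum>i\<in>I. (s j i)\<^sup>2) / (2 * real (card I)))\<bar>
    \<le> \<delta> * ((\<Sum>j\<in>J. \<Sum>i\<in>I. (s j i)\<^sup>2) / (2 * real (card I)))"
proof (cases "finite J")
  case True
  define x where "x j = (\<Sum>i\<in>I. (s j i)\<^sup>2) / (2 * real (card I))" for j
  have x0: "x j \<ge> 0" for j by (simp add: x_def sum_nonneg)
  have "\<bar>\<Sum>i\<in>I. cos (s j i)\<bar> \<le> real (card I)" for j
    using order_trans[OF sum_abs sum_bounded_above[of I "\<lambda>i. \<bar>cos (s j i)\<bar>" 1]] by simp
  then have "norm ((\<Prod>j\<in>J. (\<Sum>i\<in>I. cos (s j i)) / real (card I)) - (\<Prod>j\<in>J. exp (- x j)))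
    \<le> (\<Sum>j\<in>J. norm ((\<Sum>i\<in>I. cos (s j i)) / real (card I) - exp (- x j)))"
    using x0 assms(1,2) by (intro norm_prod_diff) (auto simp: divide_le_eq card_gt_0_iff)
  also have "\<dots> \<le> (\<Sum>j\<in>J. \<delta> * x j)"
    unfolding real_norm_def using assms by (intro sum_mono mean_cos_approx) (auto simp: x_def)
  also have "(\<Prod>j\<in>J. exp (- x j)) = exp (- (\<Sum>j\<in>J. x j))"
    using True by (simp add: sum_negf flip: exp_sum)
  finally show ?thesis
    by (simp add: x_def flip: sum_distrib_left sum_divide_distrib)
\<comment> \<open>For infinite \<open>J\<close> the sums are 0 and the product is 1 by convention,
  so both sides vanish.\<close>
qed simp

section \<open>Expectations over finitely supported product distributions\<close>

lemma expectation_pair_pmf_finite: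
  fixes f :: "'a \<times> 'b \<Rightarrow> 'c::{banach, second_countable_topology}"
  assumes p: "finite (set_pmf p)" and q: "finite (set_pmf q)"
  shows "measure_pmf.expectation (pair_pmf p q) f
    = measure_pmf.expectation p (\<lambda>a. measure_pmf.expectation q (\<lambda>b. f (a, b)))"
proof -
  have "measure_pmf.expectation (pair_pmf p q) f = (\<Sum>z\<in>set_pmf p \<times> set_pmf q. pmf (pair_pmf p q) z *\<^sub>R f z)"
    using p q by (intro integral_measure_pmf) auto
  also have "\<dots> = (\<Sum>a\<in>set_pmf p. pmf p a *\<^sub>R (\<Sum>b\<in>set_pmf q. pmf q b *\<^sub>R f (a, b)))"
    by (simp add: sum.cartesian_product pmf_pair scaleR_sum_right case_prod_unfold flip: scaleR_scaleR)
      (auto intro!: sum.cong simp: pmf_pair)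
  also have "\<dots> = measure_pmf.expectation p (\<lambda>a. \<Sum>b\<in>set_pmf q. pmf q b *\<^sub>R f (a, b))"
    using p by (intro integral_measure_pmf[symmetric]) auto
  also have "(\<lambda>a. \<Sum>b\<in>set_pmf q. pmf q b *\<^sub>R f (a, b)) = (\<lambda>a. measure_pmf.expectation q (\<lambda>b. f (a, b)))"
    using q by (intro ext integral_measure_pmf[symmetric]) auto
  finally show ?thesis .
qed

lemma finite_set_Pi_pmf:
  assumes "finite A" "\<And>x. x \<in> A \<Longrightarrow> finite (set_pmf (p x))"
  shows "finite (set_pmf (Pi_pmf A d p))"
  using assms by (simp add: set_Pi_pmf finite_PiE_dflt)

lemma expectation_prod_Pi_pmf_finite:
  fixes f :: "'a \<Rightarrow> 'b \<Rightarrow> complex"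
  assumes "finite A" "\<And>x. x \<in> A \<Longrightarrow> finite (set_pmf (p x))"
  shows "measure_pmf.expectation (Pi_pmf A d p) (\<lambda>y. \<Prod>x\<in>A. f x (y x))
    = (\<Prod>x\<in>A. measure_pmf.expectation (p x) (f x))"
  using assms
proof (induction A rule: finite_induct)
  case empty
  then show ?case by simp
next
  case (insert a A)
  have "measure_pmf.expectation (Pi_pmf (insert a A) d p) (\<lambda>y. \<Prod>x\<in>insert a A. f x (y x))
    = measure_pmf.expectation (pair_pmf (p a) (Pi_pmf A d p)) (\<lambda>(v, g). f a v * (\<Prod>x\<in>A. f x (g x)))"
    using insert.hyps unfolding Pi_pmf_insert[OF insert.hyps] integral_map_pmf
    by (intro Bochner_Integration.integral_cong refl)
      (auto simp: case_prod_unfold intro!: prod.cong)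
  also have "\<dots> = measure_pmf.expectation (p a) (f a) * (\<Prod>x\<in>A. measure_pmf.expectation (p x) (f x))"
    using insert by (subst expectation_pair_pmf_finite) (auto intro!: finite_set_Pi_pmf)
  finally show ?case using insert.hyps by simp
qed

lemma expectation_Pi_pmf_two_le:
  fixes h :: "'b \<Rightarrow> 'b \<Rightarrow> real"
  assumes A: "finite A" "i \<in> A" "j \<in> A" "i \<noteq> j" and p: "\<And>x. x \<in> A \<Longrightarrow> finite (set_pmf (p x))"
    and le: "\<And>a. a \<in> set_pmf (p i) \<Longrightarrow> measure_pmf.expectation (p j) (h a) \<le> B"
  shows "measure_pmf.expectation (Pi_pmf A d p) (\<lambda>r. h (r i) (r j)) \<le> B"
proof -
  define A' where "A' = A - {j}"
  have A': "A = insert j A'" "finite A'" "j \<notin> A'" "i \<in> A'" using A by (auto simp: A'_def)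
  have fin: "finite (set_pmf (Pi_pmf A' d p))" using A' p by (intro finite_set_Pi_pmf) auto
  have finj: "finite (set_pmf (p j))" using A p by auto
  have "measure_pmf.expectation (Pi_pmf A d p) (\<lambda>r. h (r i) (r j))
    = measure_pmf.expectation (map_pmf prod.swap (pair_pmf (p j) (Pi_pmf A' d p))) (\<lambda>(g, v). h (g i) v)"
    using A(4) unfolding A'(1) Pi_pmf_insert[OF A'(2,3)] integral_map_pmf
    by (intro Bochner_Integration.integral_cong refl) (auto simp: case_prod_unfold)
  also have "map_pmf prod.swap (pair_pmf (p j) (Pi_pmf A' d p)) = pair_pmf (Pi_pmf A' d p) (p j)"
    by (subst pair_commute_pmf) (simp add: map_pmf_comp case_prod_unfold)
  also have "measure_pmf.expectation \<dots> (\<lambda>(g, v). h (g i) v)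
    = measure_pmf.expectation (Pi_pmf A' d p) (\<lambda>g. measure_pmf.expectation (p j) (h (g i)))"
    by (subst expectation_pair_pmf_finite[OF fin finj]) simp
  also have "\<dots> \<le> measure_pmf.expectation (Pi_pmf A' d p) (\<lambda>_. B)"
  proof (rule integral_mono_AE)
    show "AE g in Pi_pmf A' d p. measure_pmf.expectation (p j) (h (g i)) \<le> B"
      using A' le by (auto simp: AE_measure_pmf_iff set_Pi_pmf PiE_dflt_def)
  qed (auto intro: integrable_measure_pmf_finite fin)
  finally show ?thesis by simp
qed

lemma expectation_rademacher: "measure_pmf.expectation rademacher f = (f (- 1) + f 1) /\<^sub>R 2"
  for f :: "real \<Rightarrow> 'c::{banach, second_countable_topology}"
  unfolding rademacher_def
  by (subst integral_measure_pmf[where A="{-1, 1}"]) (auto simp: scaleR_right_distrib indicator_def)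

lemma finite_set_rademacher [simp]: "finite (set_pmf rademacher)"
  by (simp add: rademacher_def)

lemma expectation_rademacher_iexp:
  "measure_pmf.expectation rademacher (\<lambda>s. iexp (s * u)) = complex_of_real (cos u)"
  unfolding expectation_rademacher
  by (simp add: complex_eq_iff Re_exp Im_exp)

section \<open>Convergence to the Wishart law\<close>

text \<open>Off \<open>I\<close> the functions take only the value \<open>undefined\<close>, so the
  set is a full product with singleton factors there, and Tychonoff's theorem applies.\<close>

lemma compact_PiE_fun:
  fixes C :: "'i \<Rightarrow> 'b::topological_space set"
  assumes "\<And>i. i \<in> I \<Longrightarrow> compact (C i)"
  shows "compact (PiE I C)"
proof -
  have "PiE I C = PiE UNIV (\<lambda>i. if i \<in> I then C i else {undefined})"
    by (auto simp: PiE_def Pi_def extensional_def split: if_splits)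
  moreover have "compactin (product_topology (\<lambda>_. euclidean) UNIV) (PiE UNIV (\<lambda>i. if i \<in> I then C i else {undefined}))"
    using assms by (subst compactin_PiE) auto
  ultimately show ?thesis by (simp add: euclidean_product_topology)
qed

lemma continuous_on_outer [continuous_intros]:
  "continuous_on A g \<Longrightarrow> continuous_on A (\<lambda>x. outer (g x))"
  unfolding outer_def by (intro continuous_intros)

lemma borel_measurable_sum_outer:
  assumes "\<And>i. i < k \<Longrightarrow> (\<lambda>z. g z i) \<in> borel_measurable M"
  shows "(\<lambda>z. \<Sum>i<k. outer (g z i)) \<in> borel_measurable M"
proof -
  have "(\<lambda>z. outer (g z i)) \<in> borel_measurable M" if "i < k" for i
    by (rule measurable_compose[OF assms[OF that]])
      (intro borel_measurable_continuous_onI continuous_intros)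
  then show ?thesis by (intro borel_measurable_sum) auto
qed

lemma char_PiM_mv_normal:
  fixes S :: "real ^ 'd ^ 'd" and k :: nat
  assumes S: "positive_definite S"
  shows "(\<integral>z. iexp (\<Sum>i<k. t i \<bullet> z i) \<partial>PiM {..<k} (\<lambda>_. mv_normal S))
    = complex_of_real (exp (- (\<Sum>i<k. t i \<bullet> (S *v t i)) / 2))"
proof -
  interpret mv: prob_space "mv_normal S" by (rule prob_space_mv_normal[OF S])
  interpret product_sigma_finite "\<lambda>_::nat. mv_normal S"
    by (simp add: product_sigma_finite_def mv.sigma_finite_measure_axioms)
  have meas: "(\<lambda>x. iexp (t i \<bullet> x)) \<in> borel_measurable (mv_normal S)" for i
    by (simp add: measurable_cong_sets[OF sets_mv_normal refl])
  have int: "integrable (mv_normal S) (\<lambda>x. iexp (t i \<bullet> x))" for i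
    by (rule mv.integrable_const_bound[where B=1]) (use meas[of i] in auto)
  have "iexp (\<Sum>i<k. t i \<bullet> z i) = (\<Prod>i<k. iexp (t i \<bullet> z i))" for z
    by (simp add: sum_distrib_left exp_sum)
  then have "(\<integral>z. iexp (\<Sum>i<k. t i \<bullet> z i) \<partial>PiM {..<k} (\<lambda>_. mv_normal S))
    = (\<integral>z. (\<Prod>i<k. iexp (t i \<bullet> z i)) \<partial>PiM {..<k} (\<lambda>_. mv_normal S))" by (simp only:)
  also have "\<dots> = (\<Prod>i<k. \<integral>x. iexp (t i \<bullet> x) \<partial>mv_normal S)"
    by (rule product_integral_prod[OF finite_lessThan int])
  also have "\<dots> = complex_of_real (\<Prod>i<k. exp (- (t i \<bullet> (S *v t i)) / 2))"
    unfolding char_mv_normal[OF S] by (simp only: of_real_prod)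
  also have "(\<Prod>i<k. exp (- (t i \<bullet> (S *v t i)) / 2)) = exp (- (\<Sum>i<k. t i \<bullet> (S *v t i)) / 2)"
    by (simp add: sum_divide_distrib sum_negf flip: exp_sum)
  finally show ?thesis .
qed

text \<open>The hypothesis \<open>char\<close> for all \<open>t\<close> says that the joint
  characteristic function of the \<open>k\<close> rows tends to that of independent N(0,S) vectors.
  Beyond that, the proof must supply tightness; a bounded continuous function of the Gram matrix is
  then a bounded continuous function of the rows.\<close>

theorem gram_law_converges_to_wishart:
  fixes P :: "nat \<Rightarrow> 's pmf" and Z :: "nat \<Rightarrow> 's \<Rightarrow> nat \<Rightarrow> real ^ 'd" and S :: "real ^ 'd ^ 'd"
  assumes S: "positive_definite S"
    and char: "\<And>t. (\<lambda>n. measure_pmf.expectation (P n) (\<lambda>s. iexp (\<Sum>i<k. t i \<bullet> Z n s i)))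
      \<longlonglongrightarrow> complex_of_real (exp (- (\<Sum>i<k. t i \<bullet> (S *v t i)) / 2))"
  shows "converges_in_law (\<lambda>n. distr (measure_pmf (P n)) borel (\<lambda>s. \<Sum>i<k. outer (Z n s i))) (wishart k S)"
proof -
  \<comment> \<open>Restriction to \<open>{..<k}\<close> places these laws on the same extensional
    functions that carry the product measure \<open>N\<close>, where the functionals
    \<open>l t\<close> separate points.\<close>
  define M where "M n = measure_pmf (map_pmf (\<lambda>s. \<lambda>i\<in>{..<k}. Z n s i) (P n))" for n
  define N where "N = PiM {..<k} (\<lambda>_. mv_normal S)"
  define l where "l t = (\<lambda>z :: nat \<Rightarrow> real ^ 'd. \<Sum>i<k. t i \<bullet> z i)" for t
  interpret mv: prob_space "mv_normal S" by (rule prob_space_mv_normal[OF S])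
  have pN: "prob_space N" unfolding N_def by (rule prob_space_PiM) (rule mv.prob_space_axioms)
  have l_cont: "continuous_on UNIV (l t)" for t
    unfolding l_def by (intro continuous_intros continuous_on_product_coordinates)
  have proj: "(\<lambda>z. z i) \<in> borel_measurable N" if "i < k" for i
    unfolding N_def using measurable_component_singleton[of i "{..<k}" "\<lambda>_. mv_normal S"] that
    by (simp add: measurable_cong_sets[OF refl sets_mv_normal])
  have l_meas: "l t \<in> borel_measurable N" for t
    unfolding l_def using proj by (intro borel_measurable_sum borel_measurable_inner) auto
  interpret functional_char_convergence M N "range l"
  proof (rule functional_char_convergence.intro)
    show "prob_space (M n)" for n by (simp add: M_def measure_pmf.prob_space_axioms)
    show "prob_space N" by (rule pN)
    show "continuous_on UNIV f" if "f \<in> range l" for f using that l_cont by auto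
    show "f \<in> borel_measurable (M n)" for f n by (simp add: M_def)
    show "f \<in> borel_measurable N" if "f \<in> range l" for f using that l_meas by auto
    show "(\<lambda>_. 0) \<in> range l" by (rule image_eqI[of _ _ "\<lambda>_. 0"]) (auto simp: l_def)
    show "(\<lambda>x. f x + g x) \<in> range l" if "f \<in> range l" "g \<in> range l" for f g
    proof -
      from that obtain t u where "f = l t" "g = l u" by (elim rangeE)
      then show ?thesis
        by (intro image_eqI[of _ _ "\<lambda>i. t i + u i"]) (auto simp: l_def inner_add_left sum.distrib)
    qed
    show "(\<lambda>x. c * f x) \<in> range l" if "f \<in> range l" for c f
    proof -
      from that obtain t where "f = l t" by (elim rangeE)
      then show ?thesis
        by (intro image_eqI[of _ _ "\<lambda>i. c *\<^sub>R t i"]) (auto simp: l_def sum_distrib_left)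
    qed
    show "(\<lambda>n. \<integral>x. iexp (f x) \<partial>M n) \<longlonglongrightarrow> (\<integral>x. iexp (f x) \<partial>N)" if "f \<in> range l" for f
    proof -
      from that obtain t where "f = l t" by (elim rangeE)
      then show ?thesis using char[of t] unfolding N_def by (simp only: M_def l_def char_PiM_mv_normal[OF S] integral_map_pmf)
          (simp add: lessThan_iff)
    qed
  qed
  have tight: "\<exists>K. compact K \<and> (\<forall>x\<in>K. \<forall>y\<in>K. x \<noteq> y \<longrightarrow> (\<exists>f\<in>range l. f x \<noteq> f y)) \<and>
      (\<forall>n. K \<in> sets (M n)) \<and> K \<in> sets N \<and> (\<forall>\<^sub>F n in sequentially. measure (M n) (space (M n) - K) \<le> e) \<and>
      measure N (space N - K) \<le> e" if e: "e > 0" for e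
  proof -
    \<comment> \<open>One index for each scalar coordinate of the \<open>k\<close> vectors. Each
      coordinate tail receives the share \<open>e'\<close> of \<open>e\<close> in a union bound; the
      summand 1 in \<open>e'\<close> keeps the denominator positive even if \<open>I\<close> is
      empty.\<close>
    define I where "I = {..<k} \<times> (Basis :: (real ^ 'd) set)"
    define e' where "e' = e / (real (card I) + 1)"
    have I: "finite I" by (simp add: I_def)
    have e': "e' > 0" "real (card I) * e' \<le> e" using e by (auto simp: e'_def field_simps)
    define c where "c p = (\<lambda>z :: nat \<Rightarrow> real ^ 'd. z (fst p) \<bullet> snd p)" for p :: "nat \<times> (real ^ 'd)"
    have cl: "c p = l (\<lambda>i. if i = fst p then snd p else 0)" if "p \<in> I" for p
    proof
      fix z :: "nat \<Rightarrow> real ^ 'd"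
      have "l (\<lambda>i. if i = fst p then snd p else 0) z = (\<Sum>i<k. if i = fst p then snd p \<bullet> z i else 0)"
        unfolding l_def by (intro sum.cong) auto
      then show "c p z = l (\<lambda>i. if i = fst p then snd p else 0) z"
        using that by (auto simp: c_def I_def inner_commute)
    qed
    define tails where "tails p R \<longleftrightarrow> (\<forall>\<^sub>F n in sequentially. measure (M n) {x \<in> space (M n). \<bar>c p x\<bar> > R} \<le> e')
        \<and> measure N {x \<in> space N. \<bar>c p x\<bar> > R} \<le> e'" for p R
    have "\<exists>R\<ge>0. tails p R" if "p \<in> I" for p
      unfolding tails_def
    proof (rule tail_le_of_char_convergence)
      have cL: "c p \<in> range l" using cl[OF that] by auto
      show "c p \<in> borel_measurable (M n)" "c p \<in> borel_measurable N" for n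
        using cL L_meas_M L_meas_N by auto
      show "(\<lambda>n. \<integral>x. iexp (s * c p x) \<partial>M n) \<longlonglongrightarrow> (\<integral>x. iexp (s * c p x) \<partial>N)" for s
        by (rule functional_char_convergence.char[OF functional_char_convergence_axioms L_scale[OF cL]])
    qed (use e' prob_M prob_N in auto)
    then have "\<forall>p\<in>I. \<exists>R. R \<ge> 0 \<and> tails p R" by blast
    then obtain r' where "\<forall>p\<in>I. r' p \<ge> 0 \<and> tails p (r' p)" by (rule bchoice[THEN exE])
    then obtain r where r: "\<And>p. p \<in> I \<Longrightarrow> r p \<ge> 0"
      "\<And>p. p \<in> I \<Longrightarrow> \<forall>\<^sub>F n in sequentially. measure (M n) {x \<in> space (M n). \<bar>c p x\<bar> > r p} \<le> e'"
      "\<And>p. p \<in> I \<Longrightarrow> measure N {x \<in> space N. \<bar>c p x\<bar> > r p} \<le> e'"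
      unfolding tails_def by (intro that[of r']) auto
    \<comment> \<open>The radii are nonnegative, so their sum dominates each of them and one cube
      serves all coordinates.\<close>
    define R where "R = sum r I"
    have rR: "r p \<le> R" if "p \<in> I" for p
      unfolding R_def using I r(1) that by (intro member_le_sum) auto
    \<comment> \<open>As an extensional product, \<open>K\<close> is compact and measurable for
      \<open>N\<close>, and two distinct points of it differ at some index below \<open>k\<close>. A
      full cylinder over the same cubes would have neither compactness nor separation.\<close>
    define K where "K = PiE {..<k} (\<lambda>_. cbox (- R *\<^sub>R One) (R *\<^sub>R One :: real ^ 'd))"
    have out: "\<exists>p\<in>I. \<bar>c p z\<bar> > r p" if "z \<in> extensional {..<k}" "z \<notin> K" for z
    proof -
      obtain i where i: "i < k" "z i \<notin> cbox (- R *\<^sub>R One) (R *\<^sub>R One :: real ^ 'd)"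
        using \<open>z \<notin> K\<close> \<open>z \<in> extensional {..<k}\<close> by (auto simp: K_def PiE_def)
      then obtain b where "b \<in> Basis" "\<not> \<bar>z i \<bullet> b\<bar> \<le> R" by (auto simp: mem_box abs_le_iff)
      then have p: "(i, b) \<in> I" "\<bar>c (i, b) z\<bar> > R" using i by (auto simp: I_def c_def)
      show ?thesis using p rR[OF p(1)] by (intro bexI[of _ "(i, b)"]) auto
    qed
    have bound: "measure Q (space Q - K) \<le> e" if Q: "prob_space Q"
      and cQ: "\<And>p. p \<in> I \<Longrightarrow> c p \<in> borel_measurable Q" and ext: "AE z in Q. z \<in> extensional {..<k}"
      and tail: "\<And>p. p \<in> I \<Longrightarrow> measure Q {x \<in> space Q. \<bar>c p x\<bar> > r p} \<le> e'" for Q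
    proof -
      interpret Q: prob_space Q by fact
      have ev: "{x \<in> space Q. \<bar>c p x\<bar> > r p} \<in> sets Q" if "p \<in> I" for p
        using cQ[OF that] by measurable
      have "measure Q (space Q - K) \<le> measure Q (\<Union>p\<in>I. {x \<in> space Q. \<bar>c p x\<bar> > r p})"
      proof (rule Q.finite_measure_mono_AE)
        show "AE z in Q. z \<in> space Q - K \<longrightarrow> z \<in> (\<Union>p\<in>I. {x \<in> space Q. \<bar>c p x\<bar> > r p})"
          using ext by eventually_elim (use out in auto)
      qed (use ev I in auto)
      also have "\<dots> \<le> (\<Sum>p\<in>I. measure Q {x \<in> space Q. \<bar>c p x\<bar> > r p})"
        using ev I by (intro Q.finite_measure_subadditive_finite) auto
      also have "\<dots> \<le> (\<Sum>p\<in>I. e')" by (intro sum_mono tail)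
      also have "\<dots> \<le> e" using e' by simp
      finally show ?thesis .
    qed
    have KN: "K \<in> sets N" unfolding K_def N_def by (intro sets_PiM_I_finite) auto
    have "compact K" unfolding K_def by (intro compact_PiE_fun compact_cbox)
    moreover have "\<exists>f\<in>range l. f x \<noteq> f y" if xy: "x \<in> K" "y \<in> K" "x \<noteq> y" for x y
    proof -
      have "\<exists>i\<in>{..<k}. x i \<noteq> y i"
      proof (rule ccontr)
        assume "\<not> (\<exists>i\<in>{..<k}. x i \<noteq> y i)"
        then have "x = y" using PiE_ext[OF xy(1,2)[unfolded K_def]] by blast
        with xy(3) show False ..
      qed
      then obtain i where i: "i < k" "x i \<noteq> y i" by auto
      then obtain b where b: "b \<in> Basis" "x i \<bullet> b \<noteq> y i \<bullet> b" using euclidean_eq_iff by blast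
      then have "(i, b) \<in> I" using i by (simp add: I_def)
      from cl[OF this] have "c (i, b) \<in> range l" by (simp only: rangeI)
      moreover have "c (i, b) x \<noteq> c (i, b) y" using b by (simp add: c_def)
      ultimately show ?thesis by (intro bexI)
    qed
    moreover have "\<forall>\<^sub>F n in sequentially. measure (M n) (space (M n) - K) \<le> e"
    proof -
      have "\<forall>\<^sub>F n in sequentially. \<forall>p\<in>I. measure (M n) {x \<in> space (M n). \<bar>c p x\<bar> > r p} \<le> e'"
        using I r(2) by (simp add: eventually_ball_finite_distrib)
      then show ?thesis
      proof eventually_elim
        case (elim n)
        show ?case
        proof (rule bound[OF prob_M])
          show "AE z in M n. z \<in> extensional {..<k}" unfolding M_def by (rule AE_pmfI) auto
        qed (use elim in \<open>auto simp: M_def\<close>)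
      qed
    qed
    moreover have "measure N (space N - K) \<le> e"
    proof (rule bound[OF pN])
      show "c p \<in> borel_measurable N" if "p \<in> I" for p using cl[OF that] l_meas by simp
      show "AE z in N. z \<in> extensional {..<k}" by (rule AE_I2) (auto simp: N_def space_PiM PiE_def)
    qed (rule r(3))
    ultimately show ?thesis using KN by (intro exI[of _ K]) (auto simp: M_def)
  qed
  have gN: "(\<lambda>z. \<Sum>i<k. outer (z i)) \<in> borel_measurable N"
    using proj by (rule borel_measurable_sum_outer)
  show ?thesis
    unfolding converges_in_law_def
  proof (intro allI impI)
    fix F :: "real ^ 'd ^ 'd \<Rightarrow> real"
    assume F: "continuous_on UNIV F" "bounded (range F)"
    have mF [measurable]: "F \<in> borel_measurable borel" using F(1) by (rule borel_measurable_continuous_onI)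
    define f where "f z = F (\<Sum>i<k. outer (z i))" for z
    have "(\<lambda>n. \<integral>z. f z \<partial>M n) \<longlonglongrightarrow> (\<integral>z. f z \<partial>N)"
    proof (rule integral_convergence_of_tight[OF _ _ tight])
      show "continuous_on UNIV f" unfolding f_def
        by (intro continuous_on_compose2[OF F(1)] continuous_intros continuous_on_product_coordinates) auto
      obtain B where "\<And>x. norm (F x) \<le> B" using F(2) by (auto simp: bounded_iff)
      then show "bounded_measurable f"
        unfolding bounded_measurable_def f_def using measurable_compose[OF gN mF] by (auto simp: M_def)
    qed
    moreover have "(\<integral>z. f z \<partial>M n) = (\<integral>x. F x \<partial>distr (measure_pmf (P n)) borel (\<lambda>s. \<Sum>i<k. outer (Z n s i)))" for n
      by (simp add: M_def f_def integral_distr)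
    moreover have "(\<integral>z. f z \<partial>N) = (\<integral>x. F x \<partial>wishart k S)"
      unfolding wishart_def f_def N_def[symmetric] using gN by (simp add: integral_distr)
    ultimately show "(\<lambda>n. \<integral>x. F x \<partial>distr (measure_pmf (P n)) borel (\<lambda>s. \<Sum>i<k. outer (Z n s i)))
      \<longlonglongrightarrow> (\<integral>x. F x \<partial>wishart k S)" by simp
  qed
qed

section \<open>Characteristic functions of the sketches\<close>

lemma cw_sketch_char:
  fixes w :: "nat \<Rightarrow> real ^ 'd"
  assumes k: "k \<ge> 1"
  shows "measure_pmf.expectation (cw_sketch k m) (\<lambda>S. iexp (\<Sum>i<k. t i \<bullet> (\<Sum>j<m. S i j *\<^sub>R w j)))
    = complex_of_real (\<Prod>j<m. (\<Sum>i<k. cos (t i \<bullet> w j)) / real k)"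
proof -
  \<comment> \<open>For \<open>a\<close> below \<open>k\<close> this is the inner product of
    \<open>t a\<close> with \<open>w j\<close>. The filtered sum makes the exchange of row and
    column sums valid for every value of the chosen row, so no restriction to the support is
    required.\<close>
  define G where "G j a = (\<Sum>i<k. if i = a then t i \<bullet> w j else 0)" for j a
  let ?q = "pair_pmf (pmf_of_set {..<k}) rademacher"
  have fin: "finite (set_pmf (pmf_of_set {..<k}))" using k by (subst set_pmf_of_set) (auto simp: lessThan_empty_iff)
  have "(\<Sum>i<k. t i \<bullet> (\<Sum>j<m. (if j < m \<and> i = fst (c j) then snd (c j) else 0) *\<^sub>R w j))
      = (\<Sum>j<m. snd (c j) * G j (fst (c j)))" for c :: "nat \<Rightarrow> nat \<times> real"
  proof -
    have "(\<Sum>i<k. t i \<bullet> (\<Sum>j<m. (if j < m \<and> i = fst (c j) then snd (c j) else 0) *\<^sub>R w j))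
        = (\<Sum>i<k. \<Sum>j<m. snd (c j) * (if i = fst (c j) then t i \<bullet> w j else 0))"
      by (auto simp: inner_sum_right intro!: sum.cong)
    also have "\<dots> = (\<Sum>j<m. snd (c j) * G j (fst (c j)))"
      by (subst sum.swap) (simp only: G_def sum_distrib_left)
    finally show ?thesis .
  qed
  then have "measure_pmf.expectation (cw_sketch k m) (\<lambda>S. iexp (\<Sum>i<k. t i \<bullet> (\<Sum>j<m. S i j *\<^sub>R w j)))
      = measure_pmf.expectation (Pi_pmf {..<m} (0, 0) (\<lambda>_. ?q)) (\<lambda>c. iexp (\<Sum>j<m. snd (c j) * G j (fst (c j))))"
    unfolding cw_sketch_def integral_map_pmf by (simp only:)
  also have "\<dots> = measure_pmf.expectation (Pi_pmf {..<m} (0, 0) (\<lambda>_. ?q)) (\<lambda>c. \<Prod>j<m. iexp (snd (c j) * G j (fst (c j))))"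
    by (simp add: sum_distrib_left exp_sum)
  also have "\<dots> = (\<Prod>j<m. measure_pmf.expectation ?q (\<lambda>z. iexp (snd z * G j (fst z))))"
    using fin by (intro expectation_prod_Pi_pmf_finite) auto
  also have "\<dots> = (\<Prod>j<m. complex_of_real ((\<Sum>i<k. cos (t i \<bullet> w j)) / real k))"
  proof (rule prod.cong[OF refl])
    fix j
    have "measure_pmf.expectation ?q (\<lambda>z. iexp (snd z * G j (fst z)))
        = measure_pmf.expectation (pmf_of_set {..<k}) (\<lambda>a. complex_of_real (cos (G j a)))"
      unfolding expectation_rademacher_iexp[symmetric]
      by (subst expectation_pair_pmf_finite[OF fin finite_set_rademacher]) (simp only: fst_conv snd_conv)
    also have "\<dots> = complex_of_real (measure_pmf.expectation (pmf_of_set {..<k}) (\<lambda>a. cos (G j a)))"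
      by (rule integral_complex_of_real)
    also have "measure_pmf.expectation (pmf_of_set {..<k}) (\<lambda>a. cos (G j a)) = (\<Sum>a<k. cos (G j a)) / real k"
      using k by (subst integral_pmf_of_set) (auto simp: lessThan_empty_iff)
    also have "(\<Sum>a<k. cos (G j a)) = (\<Sum>i<k. cos (t i \<bullet> w j))"
      by (auto simp: G_def intro!: sum.cong)
    finally show "measure_pmf.expectation ?q (\<lambda>z. iexp (snd z * G j (fst z)))
        = complex_of_real ((\<Sum>i<k. cos (t i \<bullet> w j)) / real k)" .
  qed
  finally show ?thesis by (simp only: of_real_prod)
qed

lemma hadamard_sketch_char:
  fixes w :: "nat \<Rightarrow> real ^ 'd"
  assumes m: "m \<ge> 1"
  shows "measure_pmf.expectation (hadamard_sketch k m H) (\<lambda>S. iexp (\<Sum>i<k. t i \<bullet> (\<Sum>j<m. S i j *\<^sub>R w j)))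
    = complex_of_real (measure_pmf.expectation (Pi_pmf {..<k} 0 (\<lambda>_. pmf_of_set {..<m}))
        (\<lambda>r. \<Prod>j<m. cos ((\<Sum>i<k. H (r i) j * (t i \<bullet> w j)) / sqrt (real k))))"
proof -
  define u where "u r j = (\<Sum>i<k. H (r i) j * (t i \<bullet> w j)) / sqrt (real k)" for r :: "nat \<Rightarrow> nat" and j
  let ?r = "Pi_pmf {..<k} 0 (\<lambda>_. pmf_of_set {..<m})" and ?d = "Pi_pmf {..<m} 0 (\<lambda>_. rademacher)"
  have finm: "set_pmf (pmf_of_set {..<m}) = {..<m}" using m by (subst set_pmf_of_set) (auto simp: lessThan_empty_iff)
  have finr: "finite (set_pmf ?r)" using finm by (intro finite_set_Pi_pmf) auto
  have find: "finite (set_pmf ?d)" by (intro finite_set_Pi_pmf) auto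
  define S where "S r d i j = (\<Sum>a<m. \<Sum>b<m. (if a = r i then 1 else 0) * H a b * (if b = j then d b else 0)) / sqrt (real k)"
    for r :: "nat \<Rightarrow> nat" and d :: "nat \<Rightarrow> real" and i j
  \<comment> \<open>Only for \<open>r\<close> in the support are the selected indices below
    \<open>m\<close>, and only then does the double sum for Phi H D collapse to a single entry of
    \<open>H\<close> times a sign. The outer expectation therefore uses this identity almost
    surely.\<close>
  have inner: "measure_pmf.expectation ?d (\<lambda>d. iexp (\<Sum>i<k. t i \<bullet> (\<Sum>j<m. S r d i j *\<^sub>R w j)))
      = complex_of_real (\<Prod>j<m. cos (u r j))" if r: "r \<in> set_pmf ?r" for r
  proof -
    have rm: "r i < m" if "i < k" for i
      using r finm that by (auto simp: set_Pi_pmf PiE_dflt_def)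
    have S: "S r d i j = H (r i) j * d j / sqrt (real k)" if "i < k" "j < m" for d i j
    proof -
      have "(\<Sum>b<m. x * H a b * (if b = j then d b else 0)) = (\<Sum>b<m. if b = j then x * H a b * d b else 0)" for x a
        by (intro sum.cong) auto
      then have "S r d i j = (\<Sum>a<m. if a = r i then H a j * d j else 0) / sqrt (real k)"
        unfolding S_def using that by (intro arg_cong2[where f="(/)"] sum.cong refl) simp
      then show ?thesis using rm that by simp
    qed
    have "(\<Sum>i<k. t i \<bullet> (\<Sum>j<m. S r d i j *\<^sub>R w j)) = (\<Sum>j<m. d j * u r j)" for d
    proof -
      have "(\<Sum>i<k. t i \<bullet> (\<Sum>j<m. S r d i j *\<^sub>R w j))
          = (\<Sum>i<k. \<Sum>j<m. d j * (H (r i) j * (t i \<bullet> w j) / sqrt (real k)))"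
        by (auto simp: inner_sum_right S intro!: sum.cong)
      also have "\<dots> = (\<Sum>j<m. d j * u r j)"
        by (subst sum.swap) (simp add: u_def sum_distrib_left sum_divide_distrib)
      finally show ?thesis .
    qed
    then have "measure_pmf.expectation ?d (\<lambda>d. iexp (\<Sum>i<k. t i \<bullet> (\<Sum>j<m. S r d i j *\<^sub>R w j)))
        = measure_pmf.expectation ?d (\<lambda>d. \<Prod>j<m. iexp (d j * u r j))"
      by (simp add: sum_distrib_left exp_sum)
    also have "\<dots> = (\<Prod>j<m. measure_pmf.expectation rademacher (\<lambda>s. iexp (s * u r j)))"
      by (rule expectation_prod_Pi_pmf_finite) auto
    finally show ?thesis unfolding expectation_rademacher_iexp by (simp only: of_real_prod)
  qed
  have "measure_pmf.expectation (hadamard_sketch k m H) (\<lambda>S. iexp (\<Sum>i<k. t i \<bullet> (\<Sum>j<m. S i j *\<^sub>R w j)))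
      = measure_pmf.expectation (pair_pmf ?r ?d) (\<lambda>z. iexp (\<Sum>i<k. t i \<bullet> (\<Sum>j<m. S (fst z) (snd z) i j *\<^sub>R w j)))"
    unfolding hadamard_sketch_def integral_map_pmf S_def case_prod_unfold ..
  also have "\<dots> = measure_pmf.expectation ?r
      (\<lambda>r. measure_pmf.expectation ?d (\<lambda>d. iexp (\<Sum>i<k. t i \<bullet> (\<Sum>j<m. S r d i j *\<^sub>R w j))))"
    by (subst expectation_pair_pmf_finite[OF finr find]) (simp only: fst_conv snd_conv)
  also have "\<dots> = measure_pmf.expectation ?r (\<lambda>r. complex_of_real (\<Prod>j<m. cos (u r j)))"
  proof (rule integral_cong_AE)
    show "AE r in ?r. measure_pmf.expectation ?d (\<lambda>d. iexp (\<Sum>i<k. t i \<bullet> (\<Sum>j<m. S r d i j *\<^sub>R w j)))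
        = complex_of_real (\<Prod>j<m. cos (u r j))"
      by (rule AE_pmfI) (rule inner)
  qed simp_all
  finally show ?thesis unfolding u_def by (simp only: integral_complex_of_real)
qed

text \<open>The rows of \<open>H\<close> are orthogonal with squared length m, so the vector
  \<open>p\<close> in the proof is m times the projection of \<open>v\<close> onto their span.
  Expanding 0 \<le> |m v - p|^2, where v . p is the sum of the squared coefficients and |p|^2 is m
  times that sum, gives the inequality.\<close>

lemma hadamard_bessel:
  assumes H: "hadamard_matrix m H" and m: "m \<ge> 1"
  shows "(\<Sum>b<m. (\<Sum>j<m. H b j * v j)\<^sup>2) \<le> real m * (\<Sum>j<m. (v j)\<^sup>2)"
proof -
  define B where "B b = (\<Sum>j<m. H b j * v j)" for b
  define p where "p j = (\<Sum>b<m. B b * H b j)" for j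
  have "(\<Sum>j<m. v j * p j) = (\<Sum>b<m. \<Sum>j<m. B b * (H b j * v j))"
    unfolding p_def sum_distrib_left by (subst sum.swap) (simp add: mult_ac)
  then have vp: "(\<Sum>j<m. v j * p j) = (\<Sum>b<m. (B b)\<^sup>2)"
    by (simp add: power2_eq_square B_def flip: sum_distrib_left)
  have "(\<Sum>j<m. (p j)\<^sup>2) = (\<Sum>j<m. \<Sum>b<m. \<Sum>c<m. B b * B c * (H b j * H c j))"
    by (simp add: power2_eq_square p_def sum_product mult_ac)
  also have "\<dots> = (\<Sum>b<m. \<Sum>c<m. \<Sum>j<m. B b * B c * (H b j * H c j))"
    by (subst sum.swap, rule sum.cong[OF refl], rule sum.swap)
  also have "\<dots> = (\<Sum>b<m. \<Sum>c<m. B b * B c * (if b = c then real m else 0))"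
    using H by (auto simp: hadamard_matrix_def simp flip: sum_distrib_left intro!: sum.cong)
  also have "\<dots> = (\<Sum>b<m. \<Sum>c<m. if c = b then real m * (B b)\<^sup>2 else 0)"
    by (intro sum.cong refl) (auto simp: power2_eq_square)
  also have "\<dots> = real m * (\<Sum>b<m. (B b)\<^sup>2)" by (simp add: sum_distrib_left)
  finally have pp: "(\<Sum>j<m. (p j)\<^sup>2) = real m * (\<Sum>b<m. (B b)\<^sup>2)" .
  have "0 \<le> (\<Sum>j<m. (real m * v j - p j)\<^sup>2)" by (intro sum_nonneg) simp
  also have "\<dots> = (\<Sum>j<m. (real m)\<^sup>2 * (v j)\<^sup>2 - 2 * real m * (v j * p j) + (p j)\<^sup>2)"
    by (intro sum.cong refl) (simp add: power2_eq_square algebra_simps)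
  also have "\<dots> = (real m)\<^sup>2 * (\<Sum>j<m. (v j)\<^sup>2) - 2 * real m * (\<Sum>j<m. v j * p j) + (\<Sum>j<m. (p j)\<^sup>2)"
    by (simp only: sum.distrib sum_subtractf sum_distrib_left)
  also have "\<dots> = real m * (real m * (\<Sum>j<m. (v j)\<^sup>2) - (\<Sum>b<m. (B b)\<^sup>2))"
    unfolding vp pp by (simp add: power2_eq_square algebra_simps)
  finally show ?thesis using m by (simp add: B_def zero_le_mult_iff)
qed

text \<open>For a fixed row \<open>a\<close> the sum is the coefficient along row \<open>b\<close>
  of the vector with entries \<open>H a j * c j\<close>, which has the same length as
  \<open>c\<close> because the entries of \<open>H\<close> are signs. Cauchy-Schwarz passes from the
  mean modulus to the mean square, and Bessel's inequality bounds the latter. The average includes b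
  = a, as selection with replacement demands.\<close>

lemma hadamard_cross_term:
  assumes H: "hadamard_matrix m H" and a: "a < m"
  shows "measure_pmf.expectation (pmf_of_set {..<m}) (\<lambda>b. \<bar>\<Sum>j<m. H a j * H b j * c j\<bar>) \<le> sqrt (\<Sum>j<m. (c j)\<^sup>2)"
proof -
  have m: "m \<ge> 1" using a by simp
  define B where "B b = (\<Sum>j<m. H b j * (H a j * c j))" for b
  have "(\<Sum>j<m. (H a j * c j)\<^sup>2) = (\<Sum>j<m. (c j)\<^sup>2)"
  proof (rule sum.cong[OF refl])
    fix j assume "j \<in> {..<m}"
    then have "H a j \<in> {-1, 1}" using H a by (auto simp: hadamard_matrix_def)
    then show "(H a j * c j)\<^sup>2 = (c j)\<^sup>2" by auto
  qed
  then have bes: "(\<Sum>b<m. (B b)\<^sup>2) \<le> real m * (\<Sum>j<m. (c j)\<^sup>2)"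
    using hadamard_bessel[OF H m, of "\<lambda>j. H a j * c j"] by (simp add: B_def)
  have "(\<Sum>b<m. \<bar>B b\<bar>)\<^sup>2 \<le> (\<Sum>b<m. (B b)\<^sup>2) * real m"
    using Cauchy_Schwarz_ineq_sum[of "\<lambda>b. \<bar>B b\<bar>" "\<lambda>_. 1" "{..<m}"] by simp
  also have "\<dots> \<le> (real m)\<^sup>2 * (\<Sum>j<m. (c j)\<^sup>2)"
    using mult_right_mono[OF bes, of "real m"] by (simp add: power2_eq_square mult_ac)
  finally have "(\<Sum>b<m. \<bar>B b\<bar>) \<le> sqrt ((real m)\<^sup>2 * (\<Sum>j<m. (c j)\<^sup>2))"
    by (rule real_le_rsqrt)
  then have "(\<Sum>b<m. \<bar>B b\<bar>) \<le> real m * sqrt (\<Sum>j<m. (c j)\<^sup>2)" by (simp add: real_sqrt_mult)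
  moreover have "measure_pmf.expectation (pmf_of_set {..<m}) (\<lambda>b. \<bar>\<Sum>j<m. H a j * H b j * c j\<bar>) = (\<Sum>b<m. \<bar>B b\<bar>) / real m"
    using m by (subst integral_pmf_of_set) (auto simp: B_def mult_ac lessThan_empty_iff)
  ultimately show ?thesis using m by (simp add: divide_le_eq mult_ac)
qed

lemma abs_exp_minus_diff_le: "\<bar>exp (- x) - exp (- y)\<bar> \<le> \<bar>x - y\<bar>" if "x \<ge> 0" "y \<ge> 0" for x y :: real
proof -
  have *: "exp (- a) - exp (- b) \<le> b - a" if "a \<ge> 0" "a \<le> b" for a b :: real
  proof -
    have "exp (- a) - exp (- b) = exp (- a) * (1 - exp (- (b - a)))"
      by (simp add: algebra_simps flip: exp_add)
    also have "\<dots> \<le> 1 * (b - a)"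
    proof (rule mult_mono)
      show "1 - exp (- (b - a)) \<le> b - a" using exp_ge_add_one_self[of "- (b - a)"] by linarith
    qed (use that in auto)
    finally show ?thesis by simp
  qed
  show ?thesis
    using *[of x y] *[of y x] that exp_le_cancel_iff[of "-x" "-y"] exp_le_cancel_iff[of "-y" "-x"]
    by (cases "x \<le> y") (auto simp: abs_if)
qed

text \<open>The selected rows are fixed, and \<open>s i j\<close> stands for the inner product of
  \<open>t i\<close> with \<open>w j\<close>. The product of the cosines is close to exp(-U/2), U
  being the sum of the squared arguments. On expanding the squares, the diagonal terms give T / k
  because the entries of \<open>H\<close> square to 1; the off-diagonal terms are the second part of
  the error.\<close>

lemma hadamard_conditional_char_approx:
  fixes s :: "nat \<Rightarrow> nat \<Rightarrow> real"
  assumes H: "hadamard_matrix m H" and r: "\<And>i. i < k \<Longrightarrow> r i < m" and k: "k \<ge> 1"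
    and \<delta>: "\<And>j. j < m \<Longrightarrow> (\<Sum>i<k. (s i j)\<^sup>2) \<le> \<delta>"
    and T: "T = (\<Sum>i<k. \<Sum>j<m. (s i j)\<^sup>2)"
  shows "\<bar>(\<Prod>j<m. cos ((\<Sum>i<k. H (r i) j * s i j) / sqrt (real k))) - exp (- (T / (2 * real k)))\<bar>
    \<le> \<delta> * T / 2 + (\<Sum>i<k. \<Sum>l\<in>{..<k} - {i}. \<bar>\<Sum>j<m. H (r i) j * H (r l) j * (s i j * s l j)\<bar>) / (2 * real k)"
proof -
  define u where "u j = (\<Sum>i<k. H (r i) j * s i j) / sqrt (real k)" for j
  define U where "U = (\<Sum>j<m. (u j)\<^sup>2)"
  have HH: "H (r i) j * H (r i) j = 1" if "i < k" "j < m" for i j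
  proof -
    have "H (r i) j \<in> {-1, 1}" using H r that by (auto simp: hadamard_matrix_def)
    then show ?thesis by auto
  qed
  have u_le: "(u j)\<^sup>2 \<le> (\<Sum>i<k. (s i j)\<^sup>2)" if "j < m" for j
  proof -
    have "(\<Sum>i<k. H (r i) j * s i j)\<^sup>2 \<le> (\<Sum>i<k. (H (r i) j * s i j)\<^sup>2) * real k"
      using Cauchy_Schwarz_ineq_sum[of "\<lambda>i. H (r i) j * s i j" "\<lambda>_. 1" "{..<k}"] by simp
    also have "(\<Sum>i<k. (H (r i) j * s i j)\<^sup>2) = (\<Sum>i<k. (s i j)\<^sup>2)"
      using HH that by (intro sum.cong refl) (auto simp: power_mult_distrib power2_eq_square)
    finally show ?thesis using k by (simp add: u_def power_divide divide_le_eq)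
  qed
  have U_le: "U \<le> T" unfolding U_def T by (subst sum.swap) (intro sum_mono u_le, auto)
  have U0: "U \<ge> 0" by (simp add: U_def sum_nonneg)
  \<comment> \<open>For m = 0 the hypothesis on \<open>\<delta>\<close> is vacuous and its sign
    unknown, but then \<open>U\<close> and \<open>T\<close> are both 0.\<close>
  have \<delta>0: "\<delta> * U \<le> \<delta> * T"
  proof (cases "m = 0")
    case True
    then show ?thesis by (simp add: U_def T)
  next
    case False
    have "0 \<le> (\<Sum>i<k. (s i 0)\<^sup>2)" by (simp add: sum_nonneg)
    with \<delta>[of 0] False have "\<delta> \<ge> 0" by linarith
    then show ?thesis using U_le by (intro mult_left_mono)
  qed
  \<comment> \<open>One cosine per column: the mean is taken over a one-point set.\<close>
  have "\<bar>(\<Prod>j<m. (\<Sum>i\<in>{()}. cos (u j)) / real (card {()})) - exp (- (\<Sum>j<m. \<Sum>i\<in>{()}. (u j)\<^sup>2) / (2 * real (card {()})))\<bar>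
    \<le> \<delta> * ((\<Sum>j<m. \<Sum>i\<in>{()}. (u j)\<^sup>2) / (2 * real (card {()})))"
    by (rule prod_mean_cos_approx) (auto intro: order_trans[OF u_le \<delta>])
  then have 1: "\<bar>(\<Prod>j<m. cos (u j)) - exp (- (U / 2))\<bar> \<le> \<delta> * T / 2"
    using \<delta>0 by (simp add: U_def)
  define V where "V i l = (\<Sum>j<m. H (r i) j * H (r l) j * (s i j * s l j))" for i l
  have "real k * U = (\<Sum>j<m. (\<Sum>i<k. H (r i) j * s i j)\<^sup>2)"
    using k by (simp add: U_def u_def power_divide flip: sum_divide_distrib)
  also have "\<dots> = (\<Sum>j<m. \<Sum>i<k. \<Sum>l<k. H (r i) j * H (r l) j * (s i j * s l j))"
    by (simp add: power2_eq_square sum_product mult_ac)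
  also have "\<dots> = (\<Sum>i<k. \<Sum>l<k. V i l)"
    unfolding V_def by (subst sum.swap, rule sum.cong[OF refl], rule sum.swap)
  also have "\<dots> = (\<Sum>i<k. V i i + (\<Sum>l\<in>{..<k} - {i}. V i l))"
    by (intro sum.cong refl sum.remove) auto
  also have "\<dots> = T + (\<Sum>i<k. \<Sum>l\<in>{..<k} - {i}. V i l)"
    by (auto simp: sum.distrib T V_def HH power2_eq_square intro!: sum.cong)
  finally have "U / 2 - T / (2 * real k) = (\<Sum>i<k. \<Sum>l\<in>{..<k} - {i}. V i l) / (2 * real k)"
    using k by (simp add: field_simps)
  also have "\<bar>\<dots>\<bar> \<le> (\<Sum>i<k. \<Sum>l\<in>{..<k} - {i}. \<bar>V i l\<bar>) / (2 * real k)"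
  proof -
    have "\<bar>\<Sum>i<k. \<Sum>l\<in>{..<k} - {i}. V i l\<bar> \<le> (\<Sum>i<k. \<Sum>l\<in>{..<k} - {i}. \<bar>V i l\<bar>)"
      by (intro order_trans[OF sum_abs] sum_mono sum_abs)
    then show ?thesis using k by (simp add: divide_right_mono)
  qed
  finally have 2: "\<bar>U / 2 - T / (2 * real k)\<bar> \<le> (\<Sum>i<k. \<Sum>l\<in>{..<k} - {i}. \<bar>V i l\<bar>) / (2 * real k)" .
  have "T \<ge> 0" using U0 U_le by simp
  then have "\<bar>exp (- (U / 2)) - exp (- (T / (2 * real k)))\<bar> \<le> \<bar>U / 2 - T / (2 * real k)\<bar>"
    using U0 by (intro abs_exp_minus_diff_le) auto
  with 1 2 show ?thesis unfolding u_def V_def by linarith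
qed

text \<open>Averaging over the selected rows costs at most sqrt (\<delta> T) for each off-diagonal
  pair: the vector in the cross term has entries \<open>s i j * s l j\<close>, and its squared
  length is at most \<delta> times the sum of the \<open>(s l j)\<^sup>2\<close>. There are at most
  k^2 such pairs, divided by 2 k.\<close>

lemma hadamard_char_approx:
  fixes s :: "nat \<Rightarrow> nat \<Rightarrow> real"
  assumes H: "hadamard_matrix m H" and m: "m \<ge> 1" and k: "k \<ge> 1"
    and \<delta>: "\<And>j. j < m \<Longrightarrow> (\<Sum>i<k. (s i j)\<^sup>2) \<le> \<delta>"
    and T: "T = (\<Sum>i<k. \<Sum>j<m. (s i j)\<^sup>2)"
  shows "\<bar>measure_pmf.expectation (Pi_pmf {..<k} 0 (\<lambda>_. pmf_of_set {..<m}))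
      (\<lambda>r. \<Prod>j<m. cos ((\<Sum>i<k. H (r i) j * s i j) / sqrt (real k))) - exp (- (T / (2 * real k)))\<bar>
    \<le> \<delta> * T / 2 + real k * sqrt (\<delta> * T)"
proof -
  let ?P = "Pi_pmf {..<k} 0 (\<lambda>_. pmf_of_set {..<m})"
  define g where "g r = (\<Prod>j<m. cos ((\<Sum>i<k. H (r i) j * s i j) / sqrt (real k)))" for r :: "nat \<Rightarrow> nat"
  define V where "V i l a b = \<bar>\<Sum>j<m. H a j * H b j * (s i j * s l j)\<bar>" for i l a b
  have finm: "set_pmf (pmf_of_set {..<m}) = {..<m}" using m by (subst set_pmf_of_set) (auto simp: lessThan_empty_iff)
  have fin: "finite (set_pmf ?P)" using finm by (intro finite_set_Pi_pmf) auto
  note int = integrable_measure_pmf_finite[OF fin]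
  have T0: "T \<ge> 0" by (simp add: T sum_nonneg)
  have \<delta>0: "\<delta> \<ge> 0" using \<delta>[of 0] m sum_nonneg[of "{..<k}" "\<lambda>i. (s i 0)\<^sup>2"] by force
  have EV: "measure_pmf.expectation ?P (\<lambda>r. V i l (r i) (r l)) \<le> sqrt (\<delta> * T)" if il: "i < k" "l < k" "i \<noteq> l" for i l
  proof (rule expectation_Pi_pmf_two_le)
    fix a assume "a \<in> set_pmf (pmf_of_set {..<m})"
    then have "measure_pmf.expectation (pmf_of_set {..<m}) (V i l a) \<le> sqrt (\<Sum>j<m. (s i j * s l j)\<^sup>2)"
      unfolding V_def finm by (intro hadamard_cross_term[OF H]) auto
    also have "\<dots> \<le> sqrt (\<Sum>j<m. \<delta> * (s l j)\<^sup>2)"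
    proof (intro real_sqrt_le_mono sum_mono)
      fix j assume "j \<in> {..<m}"
      then have "(s i j)\<^sup>2 \<le> \<delta>"
        using \<delta>[of j] member_le_sum[of i "{..<k}" "\<lambda>i. (s i j)\<^sup>2"] il by auto
      then show "(s i j * s l j)\<^sup>2 \<le> \<delta> * (s l j)\<^sup>2" by (simp add: power_mult_distrib mult_right_mono)
    qed
    also have "\<dots> \<le> sqrt (\<delta> * T)"
    proof -
      have "(\<Sum>j<m. (s l j)\<^sup>2) \<le> T"
        unfolding T using il by (intro member_le_sum[where f="\<lambda>i. \<Sum>j<m. (s i j)\<^sup>2"]) (auto simp: sum_nonneg)
      then show ?thesis using \<delta>0 by (auto simp flip: sum_distrib_left intro!: mult_left_mono)
    qed
    finally show "measure_pmf.expectation (pmf_of_set {..<m}) (V i l a) \<le> sqrt (\<delta> * T)" .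
  qed (use il finm in auto)
  have "\<bar>measure_pmf.expectation ?P g - exp (- (T / (2 * real k)))\<bar>
      = \<bar>measure_pmf.expectation ?P (\<lambda>r. g r - exp (- (T / (2 * real k))))\<bar>"
    by (subst Bochner_Integration.integral_diff[OF int int]) simp
  also have "\<dots> \<le> measure_pmf.expectation ?P (\<lambda>r. \<bar>g r - exp (- (T / (2 * real k)))\<bar>)"
    by (rule integral_abs_bound)
  also have "\<dots> \<le> measure_pmf.expectation ?P
      (\<lambda>r. \<delta> * T / 2 + (\<Sum>i<k. \<Sum>l\<in>{..<k} - {i}. V i l (r i) (r l)) / (2 * real k))"
  proof (rule integral_mono_AE[OF int int], unfold AE_measure_pmf_iff, rule ballI)
    fix r assume "r \<in> set_pmf ?P"
    then have "r i < m" if "i < k" for i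
      using finm that by (auto simp: set_Pi_pmf PiE_dflt_def)
    then show "\<bar>g r - exp (- (T / (2 * real k)))\<bar> \<le> \<delta> * T / 2 + (\<Sum>i<k. \<Sum>l\<in>{..<k} - {i}. V i l (r i) (r l)) / (2 * real k)"
      unfolding g_def V_def by (intro hadamard_conditional_char_approx[OF H _ k \<delta> T])
  qed
  also have "\<dots> = \<delta> * T / 2 + (\<Sum>i<k. \<Sum>l\<in>{..<k} - {i}. measure_pmf.expectation ?P (\<lambda>r. V i l (r i) (r l))) / (2 * real k)"
    by (simp add: int)
  also have "\<dots> \<le> \<delta> * T / 2 + (\<Sum>i<k. \<Sum>l\<in>{..<k} - {i}. sqrt (\<delta> * T)) / (2 * real k)"
    using EV by (intro add_left_mono divide_right_mono sum_mono) auto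
  also have "\<dots> \<le> \<delta> * T / 2 + real k * sqrt (\<delta> * T)"
  proof -
    have "(\<Sum>i<k. \<Sum>l\<in>{..<k} - {i}. sqrt (\<delta> * T)) \<le> (\<Sum>i<k. \<Sum>l<k. sqrt (\<delta> * T))"
      using \<delta>0 T0 by (intro sum_mono sum_mono2) auto
    also have "\<dots> = real k * real k * sqrt (\<delta> * T)" by simp
    also have "\<dots> \<le> real k * sqrt (\<delta> * T) * (2 * real k)" using \<delta>0 T0 by (simp add: mult_ac)
    finally have "(\<Sum>i<k. \<Sum>l\<in>{..<k} - {i}. sqrt (\<delta> * T)) \<le> real k * sqrt (\<delta> * T) * (2 * real k)" .
    from mult_imp_div_pos_le[OF _ this] show ?thesis using k by (intro add_left_mono) simp
  qed
  finally show ?thesis unfolding g_def .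
qed

section \<open>Asymptotics for negligible rows\<close>

lemma tendsto_of_error_bound:
  fixes a b e :: "nat \<Rightarrow> real"
  assumes "\<And>n. \<bar>a n - b n\<bar> \<le> e n" "e \<longlonglongrightarrow> 0" "b \<longlonglongrightarrow> c"
  shows "a \<longlonglongrightarrow> c"
proof -
  have "(\<lambda>n. a n - b n) \<longlonglongrightarrow> 0"
    by (rule Lim_null_comparison[OF _ assms(2)]) (use assms(1) in simp)
  from tendsto_add[OF this assms(3)] show ?thesis by simp
qed

text \<open>A Lindeberg-type setting shared by both sketches: \<open>m n\<close> is the number of
  columns, which is \<open>n\<close> itself or the padded length. The Gram matrices enter through
  their quadratic forms alone, since the approximating Gaussians depend only on sums of squared
  inner products.\<close>

locale negligible_array =
  fixes w :: "nat \<Rightarrow> nat \<Rightarrow> real ^ 'd" and m :: "nat \<Rightarrow> nat" and Q :: "real ^ 'd ^ 'd" and k :: nat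
  assumes quad: "\<And>t. (\<lambda>n. \<Sum>j<m n. (t \<bullet> w n j)\<^sup>2) \<longlonglongrightarrow> t \<bullet> (Q *v t)"
    and negligible: "\<And>e. e > 0 \<Longrightarrow> \<forall>\<^sub>F n in sequentially. \<forall>j<m n. (norm (w n j))\<^sup>2 < e"
    and k: "k \<ge> 1"
begin

text \<open>Converts smallness for large \<open>n\<close> into one null sequence that is a bound at
  every \<open>n\<close>, the form in which the approximation lemmas take their \<delta>. It is the
  largest squared row norm times the sum of the squared norms of the \<open>t i\<close>.\<close>

lemma error_sequence:
  fixes t :: "nat \<Rightarrow> real ^ 'd"
  shows "\<exists>\<delta>. \<delta> \<longlonglongrightarrow> 0 \<and> (\<forall>n. \<forall>j<m n. (\<Sum>i<k. (t i \<bullet> w n j)\<^sup>2) \<le> \<delta> n)"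
proof -
  \<comment> \<open>The inserted 0 makes the maximum meaningful when there are no rows.\<close>
  define \<beta> where "\<beta> n = Max (insert 0 ((\<lambda>j. (norm (w n j))\<^sup>2) ` {..<m n}))" for n
  have \<beta>0: "\<beta> n \<ge> 0" for n by (simp add: \<beta>_def)
  have \<beta>: "(norm (w n j))\<^sup>2 \<le> \<beta> n" if "j < m n" for n j unfolding \<beta>_def using that by (intro Max_ge) auto
  have "\<beta> \<longlonglongrightarrow> 0"
  proof (rule order_tendstoI)
    show "\<forall>\<^sub>F n in sequentially. \<beta> n > a" if "a < 0" for a
      using \<beta>0 that by (auto intro: always_eventually less_le_trans)
    show "\<forall>\<^sub>F n in sequentially. \<beta> n < a" if "a > 0" for a
      using negligible[OF that] by eventually_elim (use that in \<open>auto simp: \<beta>_def\<close>)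
  qed
  then have "(\<lambda>n. (\<Sum>i<k. (norm (t i))\<^sup>2) * \<beta> n) \<longlonglongrightarrow> (\<Sum>i<k. (norm (t i))\<^sup>2) * 0"
    by (intro tendsto_intros)
  then have "(\<lambda>n. (\<Sum>i<k. (norm (t i))\<^sup>2) * \<beta> n) \<longlonglongrightarrow> 0" by simp
  moreover have "(\<Sum>i<k. (t i \<bullet> w n j)\<^sup>2) \<le> (\<Sum>i<k. (norm (t i))\<^sup>2) * \<beta> n" if "j < m n" for n j
    unfolding sum_distrib_right
  proof (rule sum_mono)
    fix i
    have "(t i \<bullet> w n j)\<^sup>2 \<le> (norm (t i) * norm (w n j))\<^sup>2"
      using Cauchy_Schwarz_ineq2[of "t i" "w n j"] by (intro abs_le_square_iff[THEN iffD1]) auto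
    also have "\<dots> \<le> (norm (t i))\<^sup>2 * \<beta> n"
      using \<beta>[OF that] by (simp add: power_mult_distrib mult_left_mono)
    finally show "(t i \<bullet> w n j)\<^sup>2 \<le> (norm (t i))\<^sup>2 * \<beta> n" .
  qed
  ultimately show ?thesis by blast
qed

lemma total_tendsto:
  "(\<lambda>n. \<Sum>i<k. \<Sum>j<m n. (t i \<bullet> w n j)\<^sup>2) \<longlonglongrightarrow> (\<Sum>i<k. t i \<bullet> (Q *v t i))"
  by (intro tendsto_sum quad)

lemma gaussian_tendsto:
  "(\<lambda>n. exp (- ((\<Sum>i<k. \<Sum>j<m n. (t i \<bullet> w n j)\<^sup>2) / (2 * real k))))
    \<longlonglongrightarrow> exp (- (\<Sum>i<k. t i \<bullet> (((1 / real k) *\<^sub>R Q) *v t i)) / 2)"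
proof -
  have "- (\<Sum>i<k. t i \<bullet> (((1 / real k) *\<^sub>R Q) *v t i)) / 2 = - ((\<Sum>i<k. t i \<bullet> (Q *v t i)) / (2 * real k))"
    by (simp add: scaleR_matrix_vector_assoc[symmetric] sum_divide_distrib mult.commute)
  then show ?thesis
    by (simp only:) (intro tendsto_exp tendsto_minus tendsto_divide total_tendsto tendsto_const, use k in simp)
qed

lemma cw_char_tendsto:
  "(\<lambda>n. measure_pmf.expectation (cw_sketch k (m n)) (\<lambda>S. iexp (\<Sum>i<k. t i \<bullet> (\<Sum>j<m n. S i j *\<^sub>R w n j))))
    \<longlonglongrightarrow> complex_of_real (exp (- (\<Sum>i<k. t i \<bullet> (((1 / real k) *\<^sub>R Q) *v t i)) / 2))"
  unfolding cw_sketch_char[OF k]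
proof (rule tendsto_of_real)
  obtain \<delta> where \<delta>: "\<delta> \<longlonglongrightarrow> 0" "\<And>n j. j < m n \<Longrightarrow> (\<Sum>i<k. (t i \<bullet> w n j)\<^sup>2) \<le> \<delta> n"
    using error_sequence[of t] by auto
  define T where "T n = (\<Sum>i<k. \<Sum>j<m n. (t i \<bullet> w n j)\<^sup>2)" for n
  show "(\<lambda>n. \<Prod>j<m n. (\<Sum>i<k. cos (t i \<bullet> w n j)) / real k)
      \<longlonglongrightarrow> exp (- (\<Sum>i<k. t i \<bullet> (((1 / real k) *\<^sub>R Q) *v t i)) / 2)"
  proof (rule tendsto_of_error_bound[OF _ _ gaussian_tendsto])
    fix n
    have "(t i \<bullet> w n j)\<^sup>2 \<le> \<delta> n" if "j \<in> {..<m n}" "i \<in> {..<k}" for i j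
      using \<delta>(2)[of j n] member_le_sum[of i "{..<k}" "\<lambda>i. (t i \<bullet> w n j)\<^sup>2"] that by auto
    from prod_mean_cos_approx[of "{..<k}" "{..<m n}" "\<lambda>j i. t i \<bullet> w n j", OF _ _ this]
    show "\<bar>(\<Prod>j<m n. (\<Sum>i<k. cos (t i \<bullet> w n j)) / real k)
        - exp (- ((\<Sum>i<k. \<Sum>j<m n. (t i \<bullet> w n j)\<^sup>2) / (2 * real k)))\<bar> \<le> \<delta> n * (T n / (2 * real k))"
      using k by (simp add: T_def sum.swap[of _ "{..<m n}" "{..<k}"] lessThan_empty_iff)
  next
    have "(\<lambda>n. \<delta> n * (T n / (2 * real k))) \<longlonglongrightarrow> 0 * ((\<Sum>i<k. t i \<bullet> (Q *v t i)) / (2 * real k))"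
      unfolding T_def by (intro tendsto_mult tendsto_divide total_tendsto \<delta> tendsto_const) (use k in simp)
    then show "(\<lambda>n. \<delta> n * (T n / (2 * real k))) \<longlonglongrightarrow> 0" by simp
  qed
qed

lemma hadamard_char_tendsto:
  assumes H: "\<And>n. hadamard_matrix (m n) (H n)" and m: "\<And>n. m n \<ge> 1"
  shows "(\<lambda>n. measure_pmf.expectation (hadamard_sketch k (m n) (H n))
      (\<lambda>S. iexp (\<Sum>i<k. t i \<bullet> (\<Sum>j<m n. S i j *\<^sub>R w n j))))
    \<longlonglongrightarrow> complex_of_real (exp (- (\<Sum>i<k. t i \<bullet> (((1 / real k) *\<^sub>R Q) *v t i)) / 2))"
  unfolding hadamard_sketch_char[OF m]
proof (rule tendsto_of_real)
  obtain \<delta> where \<delta>: "\<delta> \<longlonglongrightarrow> 0" "\<And>n j. j < m n \<Longrightarrow> (\<Sum>i<k. (t i \<bullet> w n j)\<^sup>2) \<le> \<delta> n"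
    using error_sequence[of t] by auto
  define T where "T n = (\<Sum>i<k. \<Sum>j<m n. (t i \<bullet> w n j)\<^sup>2)" for n
  show "(\<lambda>n. measure_pmf.expectation (Pi_pmf {..<k} 0 (\<lambda>_. pmf_of_set {..<m n}))
        (\<lambda>r. \<Prod>j<m n. cos ((\<Sum>i<k. H n (r i) j * (t i \<bullet> w n j)) / sqrt (real k))))
      \<longlonglongrightarrow> exp (- (\<Sum>i<k. t i \<bullet> (((1 / real k) *\<^sub>R Q) *v t i)) / 2)"
  proof (rule tendsto_of_error_bound[OF _ _ gaussian_tendsto])
    show "\<bar>measure_pmf.expectation (Pi_pmf {..<k} 0 (\<lambda>_. pmf_of_set {..<m n}))
        (\<lambda>r. \<Prod>j<m n. cos ((\<Sum>i<k. H n (r i) j * (t i \<bullet> w n j)) / sqrt (real k)))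
        - exp (- ((\<Sum>i<k. \<Sum>j<m n. (t i \<bullet> w n j)\<^sup>2) / (2 * real k)))\<bar>
      \<le> \<delta> n * T n / 2 + real k * sqrt (\<delta> n * T n)" for n
      unfolding T_def by (rule hadamard_char_approx[OF H m k \<delta>(2) refl])
    have "(\<lambda>n. \<delta> n * T n) \<longlonglongrightarrow> 0 * (\<Sum>i<k. t i \<bullet> (Q *v t i))"
      unfolding T_def by (intro tendsto_mult total_tendsto \<delta>)
    then have "(\<lambda>n. \<delta> n * T n / 2 + real k * sqrt (\<delta> n * T n)) \<longlonglongrightarrow> 0 / 2 + real k * sqrt 0"
      by (intro tendsto_intros) auto
    then show "(\<lambda>n. \<delta> n * T n / 2 + real k * sqrt (\<delta> n * T n)) \<longlonglongrightarrow> 0" by simp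
  qed
qed

end

section \<open>Data rows, normalisation and padding\<close>

definition data_row :: "(nat \<Rightarrow> real) \<Rightarrow> (nat \<Rightarrow> real ^ 'p) \<Rightarrow> nat \<Rightarrow> real ^ 'p option" where
  "data_row y X i = (\<chi> a. case a of None \<Rightarrow> y i | Some l \<Rightarrow> X i $ l)"

lemma block_gram_eq_sum_outer: "block_gram m y X = (\<Sum>i<m. outer (data_row y X i))"
  by (simp add: vec_eq_iff block_gram_def outer_def data_row_def split: option.split)

lemma power2_norm_vec: "(norm v)\<^sup>2 = (\<Sum>a\<in>UNIV. (v $ a)\<^sup>2)" for v :: "real ^ 'd"
  unfolding power2_norm_eq_inner inner_vec_def by (simp add: power2_eq_square)

lemma norm_data_row: "(norm (data_row y X i))\<^sup>2 = (y i)\<^sup>2 + (norm (X i))\<^sup>2"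
proof -
  have "(norm (data_row y X i))\<^sup>2 = (\<Sum>a\<in>UNIV. (data_row y X i $ a)\<^sup>2)"
    by (rule power2_norm_vec)
  also have "\<dots> = (y i)\<^sup>2 + (\<Sum>l\<in>UNIV. (X i $ l)\<^sup>2)"
    by (simp add: UNIV_option_conv sum.reindex data_row_def)
  finally show ?thesis by (simp add: power2_norm_vec)
qed

lemma data_row_sketched:
  "data_row (sketched_response m S y) (sketched_covariates m S X) i = (\<Sum>j<m. S i j *\<^sub>R data_row y X j)"
  by (simp add: vec_eq_iff data_row_def sketched_response_def sketched_covariates_def split: option.split)

lemma outer_scaleR: "outer (c *\<^sub>R g) = c\<^sup>2 *\<^sub>R outer g"
  by (simp add: vec_eq_iff outer_def power2_eq_square)

lemma inner_sum_outer:
  fixes t :: "real ^ 'd"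
  shows "t \<bullet> ((\<Sum>i\<in>I. outer (g i)) *v t) = (\<Sum>i\<in>I. (t \<bullet> g i)\<^sup>2)"
proof -
  have "outer v *v t = (t \<bullet> v) *\<^sub>R v" for v :: "real ^ 'd" and t
    by (simp add: vec_eq_iff outer_def matrix_vector_mult_def inner_vec_def sum_distrib_left sum_distrib_right mult_ac)
  then have "t \<bullet> (outer v *v t) = (t \<bullet> v)\<^sup>2" for v :: "real ^ 'd" and t
    by (simp add: power2_eq_square)
  moreover have "(\<Sum>i\<in>I. outer (g i)) *v t = (\<Sum>i\<in>I. outer (g i) *v t)"
    by (induction I rule: infinite_finite_induct) (auto simp: matrix_vector_mult_add_rdistrib)
  ultimately show ?thesis by (simp add: inner_sum_right)
qed

definition normalized_row :: "nat \<Rightarrow> (nat \<Rightarrow> real) \<Rightarrow> (nat \<Rightarrow> real ^ 'p) \<Rightarrow> nat \<Rightarrow> real ^ 'p option" where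
  "normalized_row n y X j = (1 / sqrt (real n)) *\<^sub>R data_row (zero_pad n y) (zero_pad n X) j"

lemma sketched_gram_law_eq:
  "sketched_gram_law k n m \<S> y X
    = distr (measure_pmf \<S>) borel (\<lambda>S. \<Sum>i<k. outer (\<Sum>j<m. S i j *\<^sub>R normalized_row n y X j))"
proof -
  have "(\<Sum>j<m. S i j *\<^sub>R normalized_row n y X j)
      = (1 / sqrt (real n)) *\<^sub>R (\<Sum>j<m. S i j *\<^sub>R data_row (zero_pad n y) (zero_pad n X) j)"
    for S :: "nat \<Rightarrow> nat \<Rightarrow> real" and i
    by (simp add: normalized_row_def scaleR_sum_right)
  then show ?thesis
    unfolding sketched_gram_law_def block_gram_eq_sum_outer data_row_sketched
    by (simp add: outer_scaleR power_divide flip: scaleR_sum_right)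
qed

lemma normalized_row_eq:
  "normalized_row n y X j = (if j < n then (1 / sqrt (real n)) *\<^sub>R data_row y X j else 0)"
  by (auto simp: normalized_row_def data_row_def zero_pad_def vec_eq_iff split: option.split)

text \<open>The rows from \<open>n\<close> on are zero, so padding to \<open>m\<close> columns
  leaves the quadratic form of the original Gram matrix unchanged.\<close>

lemma normalized_row_quadratic_form:
  assumes "n \<le> m"
  shows "(\<Sum>j<m. (t \<bullet> normalized_row n y X j)\<^sup>2) = t \<bullet> (((1 / real n) *\<^sub>R block_gram n y X) *v t)"
proof -
  have "(\<Sum>j<m. (t \<bullet> normalized_row n y X j)\<^sup>2) = (\<Sum>j<n. (t \<bullet> normalized_row n y X j)\<^sup>2)"
    using assms by (intro sum.mono_neutral_right) (auto simp: normalized_row_eq)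
  also have "\<dots> = (\<Sum>j<n. (1 / real n) * (t \<bullet> data_row y X j)\<^sup>2)"
    by (intro sum.cong) (auto simp: normalized_row_eq power_divide)
  also have "\<dots> = t \<bullet> (((1 / real n) *\<^sub>R block_gram n y X) *v t)"
    by (simp add: block_gram_eq_sum_outer scaleR_matrix_vector_assoc[symmetric] inner_sum_outer
        sum_divide_distrib)
  finally show ?thesis .
qed

lemma tendsto_quadratic_form:
  fixes A :: "nat \<Rightarrow> real ^ 'd ^ 'd"
  assumes "A \<longlonglongrightarrow> Q"
  shows "(\<lambda>n. t \<bullet> (A n *v t)) \<longlonglongrightarrow> t \<bullet> (Q *v t)"
  unfolding inner_vec_def matrix_vector_mult_def vec_lambda_beta
  by (intro tendsto_sum tendsto_mult tendsto_inner tendsto_const tendsto_vec_nth assms)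

section \<open>Accumulating data have negligible rows\<close>

text \<open>\<open>a n\<close> is a difference of consecutive partial sums; after division by n + 1
  both of them tend to \<open>c\<close>.\<close>

lemma last_term_negligible_of_mean_convergence:
  fixes a :: "nat \<Rightarrow> real"
  assumes "(\<lambda>n. (\<Sum>i<n. a i) / real n) \<longlonglongrightarrow> c"
  shows "(\<lambda>n. a n / real (Suc n)) \<longlonglongrightarrow> 0"
proof -
  define s where "s n = (\<Sum>i<n. a i) / real n" for n
  have s: "s \<longlonglongrightarrow> c" using assms by (simp add: s_def[abs_def])
  have "a n / real (Suc n) = s (Suc n) - s n * (real n / real (Suc n))" for n
  proof -
    have "s n * (real n / real (Suc n)) = (\<Sum>i<n. a i) / real (Suc n)" by (cases "n = 0") (simp_all add: s_def)
    then show ?thesis by (simp add: s_def add_divide_distrib)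
  qed
  moreover have "(\<lambda>n. s (Suc n) - s n * (real n / real (Suc n))) \<longlonglongrightarrow> c - c * 1"
    by (intro tendsto_diff tendsto_mult s LIMSEQ_Suc LIMSEQ_n_over_Suc_n)
  ultimately show ?thesis by simp
qed

text \<open>Split at an index \<open>N\<close> beyond which \<open>a i / real (Suc i)\<close> is
  below \<open>e\<close>. The earlier terms are bounded by the constant \<open>A\<close>, which is
  negligible against \<open>n\<close>; for the later ones i < n allows \<open>n\<close> to be
  replaced by the smaller i + 1.\<close>

lemma max_term_negligible:
  fixes a :: "nat \<Rightarrow> real"
  assumes a0: "\<And>i. a i \<ge> 0" and lim: "(\<lambda>n. a n / real (Suc n)) \<longlonglongrightarrow> 0" and e: "e > 0"
  shows "\<forall>\<^sub>F n in sequentially. \<forall>i<n. a i / real n < e"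
proof -
  obtain N where N: "\<And>i. i \<ge> N \<Longrightarrow> a i / real (Suc i) < e"
    using order_tendstoD(2)[OF lim e] by (auto simp: eventually_sequentially)
  define A where "A = (\<Sum>i<N. a i)"
  have "\<forall>\<^sub>F n in sequentially. A / e < real n"
    using filterlim_real_sequentially unfolding filterlim_at_top_dense by blast
  then show ?thesis
  proof eventually_elim
    case (elim n)
    show ?case
    proof (intro allI impI)
      fix i assume i: "i < n"
      show "a i / real n < e"
      proof (cases "i < N")
        case True
        then have "a i \<le> A" unfolding A_def using a0 by (intro member_le_sum) auto
        also have "A < e * real n" using elim e by (simp add: field_simps)
        finally show ?thesis using i by (simp add: divide_less_eq)
      next
        case False
        have "a i / real n \<le> a i / real (Suc i)" using i a0 by (intro divide_left_mono) auto
        with N[of i] False show ?thesis by simp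
      qed
    qed
  qed
qed

lemma accumulating_eq:
  assumes "accumulating y X" "i < n"
  shows "y n i = y (Suc i) i \<and> X n i = X (Suc i) i"
  using assms(2)
proof (induction n)
  case (Suc n)
  then show ?case using assms(1) by (cases "i = n") (auto simp: accumulating_def)
qed simp

text \<open>When rows never change, the array is a single sequence, and the trace of the normalised
  Gram matrix is the running mean of the squared row norms. Convergence of this mean makes the
  newest row negligible, and hence the largest one.\<close>

lemma accumulating_imp_negligible_rows:
  fixes X :: "nat \<Rightarrow> nat \<Rightarrow> real ^ 'p"
  assumes acc: "accumulating y X"
    and lim: "(\<lambda>n. (1 / real n) *\<^sub>R block_gram n (y n) (X n)) \<longlonglongrightarrow> Q"
  shows "negligible_rows y X"
proof -
  define a where "a i = (y (Suc i) i)\<^sup>2 + (norm (X (Suc i) i))\<^sup>2" for i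
  have a: "(y n i)\<^sup>2 + (norm (X n i))\<^sup>2 = a i" if "i < n" for n i
    using accumulating_eq[OF acc that] by (simp add: a_def)
  have trace: "(\<Sum>b\<in>UNIV. ((1 / real n) *\<^sub>R block_gram n (y n) (X n)) $ b $ b) = (\<Sum>i<n. a i) / real n" for n
  proof -
    have "(\<Sum>b\<in>UNIV. outer v $ b $ b) = (norm v)\<^sup>2" for v :: "real ^ 'p option"
      unfolding power2_norm_vec outer_def by (simp add: power2_eq_square)
    then have "(\<Sum>b\<in>UNIV. block_gram n (y n) (X n) $ b $ b) = (\<Sum>i<n. (norm (data_row (y n) (X n) i))\<^sup>2)"
      unfolding block_gram_eq_sum_outer sum_component by (subst sum.swap) (simp only:)
    also have "\<dots> = (\<Sum>i<n. a i)" by (intro sum.cong) (auto simp: norm_data_row a)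
    finally show ?thesis by (simp add: sum_divide_distrib[symmetric])
  qed
  have "(\<lambda>n. \<Sum>b\<in>UNIV. ((1 / real n) *\<^sub>R block_gram n (y n) (X n)) $ b $ b) \<longlonglongrightarrow> (\<Sum>b\<in>UNIV. Q $ b $ b)"
    by (intro tendsto_sum tendsto_vec_nth lim)
  then have "(\<lambda>n. a n / real (Suc n)) \<longlonglongrightarrow> 0"
    unfolding trace by (rule last_term_negligible_of_mean_convergence)
  then have "\<forall>\<^sub>F n in sequentially. \<forall>i<n. a i / real n < e" if "e > 0" for e
    using that by (intro max_term_negligible) (auto simp: a_def)
  then show ?thesis
    unfolding negligible_rows_def using a by (auto elim!: eventually_mono)
qed

lemma next_pow2_ge: "n \<le> next_pow2 n" "next_pow2 n \<ge> 1"
proof -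
  have "n \<le> 2 ^ n" by simp
  then show "n \<le> next_pow2 n" unfolding next_pow2_def by (rule LeastI)
  show "next_pow2 n \<ge> 1" by (simp add: next_pow2_def)
qed

lemma negligible_array_normalized_rows:
  fixes X :: "nat \<Rightarrow> nat \<Rightarrow> real ^ 'p"
  assumes lim: "(\<lambda>n. (1 / real n) *\<^sub>R block_gram n (y n) (X n)) \<longlonglongrightarrow> Q"
    and neg: "negligible_rows y X" and m: "\<And>n. n \<le> m n" and k: "k \<ge> 1"
  shows "negligible_array (\<lambda>n. normalized_row n (y n) (X n)) m Q k"
proof
  show "(\<lambda>n. \<Sum>j<m n. (t \<bullet> normalized_row n (y n) (X n) j)\<^sup>2) \<longlonglongrightarrow> t \<bullet> (Q *v t)" for t
    unfolding normalized_row_quadratic_form[OF m] by (rule tendsto_quadratic_form[OF lim])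
  show "\<forall>\<^sub>F n in sequentially. \<forall>j<m n. (norm (normalized_row n (y n) (X n) j))\<^sup>2 < e" if "e > 0" for e
  proof -
    have "\<forall>\<^sub>F n in sequentially. \<forall>i<n. ((y n i)\<^sup>2 + (norm (X n i))\<^sup>2) / real n < e"
      using neg that by (auto simp: negligible_rows_def)
    then show ?thesis
      by eventually_elim (use that in \<open>auto simp: normalized_row_eq power_divide norm_data_row\<close>)
  qed
qed (rule k)

lemma positive_definite_scaleR:
  assumes "positive_definite Q" "c > 0"
  shows "positive_definite (c *\<^sub>R Q)"
  using assms
  by (auto simp: positive_definite_def scaleR_matrix_vector_assoc[symmetric] transpose_def vec_eq_iff)

theorem mainTheorem9:
  fixes y :: "nat \<Rightarrow> nat \<Rightarrow> real"
    and X :: "nat \<Rightarrow> nat \<Rightarrow> real ^ 'p"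
    and Q :: "real ^ 'p option ^ 'p option"
    and k :: nat
  assumes "k \<ge> 1"
    and "positive_definite Q"
    and "(\<lambda>n. (1 / real n) *\<^sub>R block_gram n (y n) (X n)) \<longlonglongrightarrow> Q"
    and "accumulating y X \<or> negligible_rows y X"
  shows "converges_in_law (\<lambda>n. sketched_gram_law k n n (cw_sketch k n) (y n) (X n))
           (wishart k ((1 / real k) *\<^sub>R Q))
       \<and> (\<forall>H. (\<forall>n. hadamard_matrix (next_pow2 n) (H n)) \<longrightarrow>
            converges_in_law
              (\<lambda>n. sketched_gram_law k n (next_pow2 n)
                     (hadamard_sketch k (next_pow2 n) (H n)) (y n) (X n))
              (wishart k ((1 / real k) *\<^sub>R Q)))"
proof -
  \<comment> \<open>Both alternatives of the hypothesis lead to the condition on the largest row,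
    which is the form the array argument takes.\<close>
  have neg: "negligible_rows y X" using assms(3,4) accumulating_imp_negligible_rows by blast
  have S: "positive_definite ((1 / real k) *\<^sub>R Q)" using assms(1,2) by (intro positive_definite_scaleR) auto
  interpret cw: negligible_array "\<lambda>n. normalized_row n (y n) (X n)" "\<lambda>n. n" Q k
    using assms(1,3) neg by (intro negligible_array_normalized_rows) auto
  interpret had: negligible_array "\<lambda>n. normalized_row n (y n) (X n)" next_pow2 Q k
    using assms(1,3) neg next_pow2_ge by (intro negligible_array_normalized_rows) auto
  show ?thesis
    unfolding sketched_gram_law_eq
    by (intro conjI allI impI gram_law_converges_to_wishart[OF S] cw.cw_char_tendsto
        had.hadamard_char_tendsto next_pow2_ge) blast
qed

end
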